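(* Let $H$ be a complex Hilbert space, let $A$ be a (possibly unbounded) normal operator in $H$ and let $B$ be a bounded normal operator on $H$. Assume that $BA\subset \lambda AB\neq 0$, where $\lambda\in\mathbb{C}$. Then $AB$ is normal if and only if $|\lambda|=1$.
   Context: An unbounded operator $T$ with domain $D(T)\subseteq H$ is normal if it is densely defined, closed and $TT^*=T^*T$ (equality including domains). Products have their natural domains: $D(ST)=\{x\in D(T): Tx\in D(S)\}$; for $B$ bounded (everywhere defined), $D(BA)=D(A)$ and $D(AB)=\{x\in H: Bx\in D(A)\}$. $S\subset T$ means $D(S)\subseteq D(T)$ and $Sx=Tx$ for all $x\in D(S)$. The condition $BA\subset\lambda AB\neq 0$ means that $BA\subset\lambda AB$ and that $\lambda AB$ is not the zero operator on its domain (in particular $\lambda\ne 0$). *)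

theory Defs
  imports "HOL-Analysis.Analysis"
begin

section \<open>Complex Hilbert spaces\<close>

text \<open>The inner product is linear in its first and conjugate-linear in its second argument.
  Completeness, and the compatibility of the norm with the metric and the topology, come from
  the superclass \<^class>\<open>banach\<close>.\<close>

class complex_hilbert = banach +
  fixes scaleC :: "complex \<Rightarrow> 'a \<Rightarrow> 'a"  (infixr \<open>*\<^sub>C\<close> 75)
    and cinner :: "'a \<Rightarrow> 'a \<Rightarrow> complex"
  assumes scaleC_add_right: "c *\<^sub>C (x + y) = c *\<^sub>C x + c *\<^sub>C y"
    and scaleC_add_left: "(c + d) *\<^sub>C x = c *\<^sub>C x + d *\<^sub>C x"
    and scaleC_scaleC: "c *\<^sub>C d *\<^sub>C x = (c * d) *\<^sub>C x"
    and scaleC_one: "1 *\<^sub>C x = x"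
    and scaleR_scaleC: "r *\<^sub>R x = complex_of_real r *\<^sub>C x"
    and cinner_commute: "cinner x y = cnj (cinner y x)"
    and cinner_add_left: "cinner (x + y) z = cinner x z + cinner y z"
    and cinner_scaleC_left: "cinner (c *\<^sub>C x) y = c * cinner x y"
    and cinner_self_norm: "cinner x x = complex_of_real ((norm x)\<^sup>2)"

instantiation complex :: complex_hilbert
begin

definition scaleC_complex :: "complex \<Rightarrow> complex \<Rightarrow> complex"
  where "scaleC_complex c x = c * x"

definition cinner_complex :: "complex \<Rightarrow> complex \<Rightarrow> complex"
  where "cinner_complex x y = x * cnj y"

instance
proof
  fix x :: complex
  show "cinner x x = complex_of_real ((norm x)\<^sup>2)"
    by (metis cinner_complex_def complex_norm_square of_real_power)
qed (simp_all add: scaleC_complex_def cinner_complex_def scaleR_conv_of_real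
       distrib_left distrib_right mult.commute)

end

section \<open>Unbounded operators\<close>

text \<open>An operator is a partial function, and its domain is its \<^const>\<open>dom\<close>. Therefore

  \<^item> HOL equality of operators is equality including domains;
  \<^item> \<^term>\<open>S \<subseteq>\<^sub>m T\<close> says that \<^term>\<open>T\<close> extends \<^term>\<open>S\<close>;
  \<^item> \<^term>\<open>S \<circ>\<^sub>m T\<close> is the product with its natural domain, all \<^term>\<open>x\<close> in the domain of
    \<^term>\<open>T\<close> whose image lies in the domain of \<^term>\<open>S\<close>.\<close>

definition linear_operator :: "('a::complex_hilbert \<rightharpoonup> 'a) \<Rightarrow> bool" where
  "linear_operator T \<longleftrightarrow>
     0 \<in> dom T \<and>
     (\<forall>x\<in>dom T. \<forall>y\<in>dom T. T (x + y) = Some (the (T x) + the (T y))) \<and>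
     (\<forall>c. \<forall>x\<in>dom T. T (c *\<^sub>C x) = Some (c *\<^sub>C the (T x)))"

definition bounded_operator :: "('a::complex_hilbert \<rightharpoonup> 'a) \<Rightarrow> bool" where
  "bounded_operator T \<longleftrightarrow>
     linear_operator T \<and> dom T = UNIV \<and> (\<exists>K. \<forall>x. norm (the (T x)) \<le> K * norm x)"

definition densely_defined :: "('a::complex_hilbert \<rightharpoonup> 'a) \<Rightarrow> bool" where
  "densely_defined T \<longleftrightarrow> closure (dom T) = UNIV"

definition closed_operator :: "('a::complex_hilbert \<rightharpoonup> 'a) \<Rightarrow> bool" where
  "closed_operator T \<longleftrightarrow> closed (Map.graph T)"

text \<open>The vector chosen below is unique, and hence the adjoint meaningful, exactly when the
  operator is densely defined.\<close>

definition adjoint_operator :: "('a::complex_hilbert \<rightharpoonup> 'a) \<Rightarrow> ('a \<rightharpoonup> 'a)" where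
  "adjoint_operator T y =
     (if \<exists>z. \<forall>x\<in>dom T. cinner (the (T x)) y = cinner x z
      then Some (SOME z. \<forall>x\<in>dom T. cinner (the (T x)) y = cinner x z)
      else None)"

definition normal_operator :: "('a::complex_hilbert \<rightharpoonup> 'a) \<Rightarrow> bool" where
  "normal_operator T \<longleftrightarrow>
     linear_operator T \<and> densely_defined T \<and> closed_operator T \<and>
     T \<circ>\<^sub>m adjoint_operator T = adjoint_operator T \<circ>\<^sub>m T"

text \<open>The domain of a scalar multiple is that of the operator, even for the scalar 0.\<close>

definition scale_operator :: "complex \<Rightarrow> ('a::complex_hilbert \<rightharpoonup> 'a) \<Rightarrow> ('a \<rightharpoonup> 'a)" where
  "scale_operator c T = map_option ((*\<^sub>C) c) \<circ> T"

end

theory Submission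
  imports Defs
begin

text \<open>Fuglede's theorem gives \<open>B A\<^sup>* \<subseteq> \<lambda>\<^sup>* A\<^sup>* B\<close>, so on the domain of \<open>A\<close>, by normality of \<open>A\<close>
  and \<open>B\<close>, the norm of \<open>(A B)\<^sup>* x = B\<^sup>* A\<^sup>* x\<close> is \<open>|\<lambda>|\<close> times that of \<open>A B x\<close>. If \<open>A B\<close> is normal, the two
  norms agree and \<open>|\<lambda>| = 1\<close>. Conversely, if \<open>|\<lambda>| = 1\<close>, then \<open>B\<close> commutes with the resolvent
  \<open>(1 + A\<^sup>* A)\<^sup>-\<^sup>1\<close>; this makes the domain of \<open>A\<close> a core for \<open>A B\<close> and for its adjoint, and the
  equality of norms extends to the full domains.

  Fuglede's theorem is proved without spectral theory. If \<open>B N \<subseteq> M B\<close> with \<open>N\<close> and \<open>M\<close> normal, then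
  the norm of \<open>(1 + M\<^sup>* M)\<^sup>m B (1 + N\<^sup>* N)\<^sup>-\<^sup>m\<close> is bounded uniformly in \<open>m\<close>. By an argument of Lax such
  a bound improves to the operator norm, also for \<open>V + i \<alpha>\<close> in place of the symmetric
  \<open>V = (B, B\<^sup>*)\<close> on \<open>H \<times> H\<close>, which forces \<open>B\<close> to intertwine \<open>N\<^sup>* N\<close> and \<open>M\<^sup>* M\<close>. Taking
  \<open>(N, M) = (A, \<lambda> A)\<close> and \<open>(A + 1, \<lambda> A + 1)\<close> and expanding isolates the terms linear in \<open>A\<^sup>*\<close>.\<close>

section \<open>Complex Hilbert spaces\<close>

lemma cinner_add_right: "cinner x (y + z) = cinner x y + cinner x z"
  by (metis cinner_add_left cinner_commute complex_cnj_add)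

lemma cinner_scaleC_right: "cinner x (c *\<^sub>C y) = cnj c * cinner x y"
  by (metis cinner_scaleC_left cinner_commute complex_cnj_mult)

lemma scaleC_minus_one: "(- 1) *\<^sub>C x = - (x::'a::complex_hilbert)"
  using scaleR_scaleC[of "-1" x] by simp

lemma cinner_minus_left: "cinner (- x) y = - cinner x y"
  using cinner_scaleC_left[of "-1" x y] by (simp add: scaleC_minus_one)

lemma cinner_minus_right: "cinner x (- y) = - cinner x y"
  using cinner_scaleC_right[of x "-1" y] by (simp add: scaleC_minus_one)

lemma cinner_diff_left: "cinner (x - y) z = cinner x z - cinner y z"
  using cinner_add_left[of x "- y" z] by (simp add: cinner_minus_left)

lemma cinner_diff_right: "cinner x (y - z) = cinner x y - cinner x z"
  using cinner_add_right[of x y "- z"] by (simp add: cinner_minus_right)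

lemma cinner_zero_left [simp]: "cinner 0 y = 0"
  using cinner_diff_left[of y y y] by simp

lemma cinner_zero_right [simp]: "cinner x 0 = 0"
  using cinner_diff_right[of x x x] by simp

lemma scaleC_zero_left [simp]: "0 *\<^sub>C x = (0::'a::complex_hilbert)"
  using scaleC_add_left[of 0 0 x] by simp

lemma scaleC_zero_right [simp]: "c *\<^sub>C 0 = (0::'a::complex_hilbert)"
  using scaleC_add_right[of c 0 "0::'a"] by simp

lemma scaleC_minus_right: "c *\<^sub>C (- x) = - (c *\<^sub>C (x::'a::complex_hilbert))"
  using scaleC_add_right[of c x "- x"] by (simp add: eq_neg_iff_add_eq_0 add.commute)

lemma scaleC_diff_right: "c *\<^sub>C (x - y) = c *\<^sub>C x - c *\<^sub>C (y::'a::complex_hilbert)"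
  using scaleC_add_right[of c x "- y"] by (simp add: scaleC_minus_right)

lemma scaleC_inverse_cancel [simp]:
  assumes "c \<noteq> 0"
  shows "c *\<^sub>C inverse c *\<^sub>C x = (x::'a::complex_hilbert)"
    "inverse c *\<^sub>C c *\<^sub>C x = (x::'a::complex_hilbert)"
  using assms by (simp_all add: scaleC_scaleC scaleC_one)

lemmas cinner_simps = cinner_add_left cinner_add_right cinner_diff_left cinner_diff_right
  cinner_minus_left cinner_minus_right cinner_scaleC_left cinner_scaleC_right

lemma Re_cinner_self: "Re (cinner x x) = (norm x)\<^sup>2"
  by (simp add: cinner_self_norm)

lemma Re_cinner_commute: "Re (cinner y x) = Re (cinner x y)"
  using cinner_commute[of y x] by simp

lemma cinner_eqI: "(\<And>y. cinner a y = cinner b y) \<Longrightarrow> a = b"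
  using cinner_self_norm[of "a - b"] by (simp add: cinner_diff_left)

lemma norm_add_square: "(norm (x + y))\<^sup>2 = (norm x)\<^sup>2 + (norm y)\<^sup>2 + 2 * Re (cinner x y)"
proof -
  have "(norm (x + y))\<^sup>2 = Re (cinner (x + y) (x + y))"
    by (simp add: Re_cinner_self)
  then show ?thesis
    by (simp add: cinner_simps Re_cinner_self Re_cinner_commute[of y x])
qed

lemma norm_diff_square: "(norm (x - y))\<^sup>2 = (norm x)\<^sup>2 + (norm y)\<^sup>2 - 2 * Re (cinner x y)"
  using norm_add_square[of x "- y"] by (simp add: cinner_minus_right)

lemma norm_scaleC: "norm (c *\<^sub>C x) = cmod c * norm x"
proof -
  have "complex_of_real ((norm (c *\<^sub>C x))\<^sup>2) = (c * cnj c) * cinner x x"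
    unfolding cinner_self_norm[symmetric] by (simp add: cinner_simps)
  also have "\<dots> = complex_of_real ((cmod c * norm x)\<^sup>2)"
    by (simp add: complex_norm_square[symmetric] cinner_self_norm power_mult_distrib)
  finally have "(norm (c *\<^sub>C x))\<^sup>2 = (cmod c * norm x)\<^sup>2"
    using of_real_eq_iff by blast
  then show ?thesis
    by (simp add: power2_eq_iff_nonneg)
qed

text \<open>Stated for an arbitrary positive semidefinite form because it is also needed for
  \<open>\<lambda>x y. cinner (D x) y\<close> with a positive operator \<open>D\<close>.\<close>

lemma cauchy_schwarz_form:
  fixes D :: "'a::complex_hilbert \<Rightarrow> 'a"
  assumes sym: "\<And>x y. cinner (D x) y = cinner x (D y)"
    and pos: "\<And>x. 0 \<le> Re (cinner (D x) x)"
  shows "(cmod (cinner (D x) y))\<^sup>2 \<le> Re (cinner (D x) x) * Re (cinner (D y) y)"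
proof -
  define a where "a = cinner (D x) y"
  define p where "p = Re (cinner (D x) x)"
  define q where "q = Re (cinner (D y) y)"
  have yx: "cinner (D y) x = cnj a"
    unfolding a_def by (metis cinner_commute sym)
  have Dlin: "D (u - c *\<^sub>C v) = D u - c *\<^sub>C D v" for u v c
    by (rule cinner_eqI) (simp add: sym cinner_simps)
  \<comment> \<open>The form evaluated at \<open>x - t a y\<close>; including the phase of
    \<open>a\<close> makes each cross term contribute \<open>- t |a|^2\<close>.\<close>
  have main: "0 \<le> p - 2 * t * (cmod a)\<^sup>2 + t\<^sup>2 * (cmod a)\<^sup>2 * q" for t :: real
  proof -
    let ?c = "complex_of_real t * a"
    have a2: "Re a * Re a + Im a * Im a = (cmod a)\<^sup>2"
      by (simp add: cmod_power2 flip: power2_eq_square)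
    have imy: "Im (cinner (D y) y) = 0"
      using sym[of y y] cinner_commute[of y "D y"] by (simp add: complex_eq_iff)
    have "0 \<le> Re (cinner (D (x - ?c *\<^sub>C y)) (x - ?c *\<^sub>C y))"
      by (rule pos)
    also have "\<dots> = p - Re (cnj ?c * a) - Re (?c * cnj a) + Re (?c * cnj ?c * cinner (D y) y)"
      unfolding Dlin by (simp add: cinner_simps yx p_def flip: a_def) (simp add: algebra_simps)
    also have "\<dots> = p - 2 * t * (Re a * Re a + Im a * Im a)
       + t\<^sup>2 * (Re a * Re a + Im a * Im a) * q"
      using imy by (simp add: q_def algebra_simps power2_eq_square)
    finally show ?thesis
      unfolding a2 .
  qed
  have "(cmod a)\<^sup>2 \<le> p * q"
  proof (cases "q = 0")
    case True
    have "2 * t * (cmod a)\<^sup>2 \<le> p" for t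
      using main[of t] True by simp
    \<comment> \<open>In the degenerate case the bound is linear in \<open>t\<close> and fails at
      this value unless \<open>a = 0\<close>.\<close>
    from this[of "(p + 1) / (2 * (cmod a)\<^sup>2)"] have "cmod a = 0"
      by (cases "cmod a = 0") auto
    then show ?thesis
      by (simp add: True)
  next
    case False
    then have q: "q > 0"
      using pos[of y] by (simp add: q_def)
    have "0 \<le> p - (cmod a)\<^sup>2 / q"
      using main[of "1 / q"] q by (simp add: field_simps power2_eq_square)
    then show ?thesis
      using q by (simp add: field_simps)
  qed
  then show ?thesis
    by (simp add: a_def p_def q_def)
qed

lemma cauchy_schwarz: "cmod (cinner x y) \<le> norm x * norm y"
proof -
  have "(cmod (cinner x y))\<^sup>2 \<le> (norm x * norm y)\<^sup>2"
    using cauchy_schwarz_form[of "\<lambda>x. x" x y] by (simp add: Re_cinner_self power_mult_distrib)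
  then show ?thesis
    by (rule power2_le_imp_le) simp
qed

lemma bounded_linear_cinner_left: "bounded_linear (\<lambda>x. cinner x y)"
proof (rule bounded_linear_intro)
  show "norm (cinner x y) \<le> norm x * norm y" for x
    by (rule cauchy_schwarz)
qed (simp_all add: cinner_simps scaleR_scaleC scaleC_complex_def)

lemma bounded_linear_cinner_right: "bounded_linear (\<lambda>y. cinner x y)"
proof (rule bounded_linear_intro)
  show "norm (cinner x y) \<le> norm y * norm x" for y
    using cauchy_schwarz[of x y] by (simp add: mult.commute)
qed (simp_all add: cinner_simps scaleR_scaleC scaleC_complex_def)

lemma orthogonal_to_dense:
  assumes "closure S = UNIV" and "\<And>x. x \<in> S \<Longrightarrow> cinner x z = 0"
  shows "z = 0"
proof -
  have "z \<in> closure S"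
    using assms(1) by simp
  then obtain s where s: "\<And>n. s n \<in> S" "s \<longlonglongrightarrow> z"
    unfolding closure_sequential by blast
  have "(\<lambda>n. cinner (s n) z) \<longlonglongrightarrow> cinner z z"
    by (rule bounded_linear.tendsto[OF bounded_linear_cinner_left s(2)])
  then have "cinner z z = 0"
    using assms(2) s(1) by (simp add: LIMSEQ_const_iff)
  then show ?thesis
    by (simp add: cinner_self_norm)
qed

section \<open>Orthogonal sums of Hilbert spaces\<close>

instantiation prod :: (complex_hilbert, complex_hilbert) complex_hilbert
begin

definition scaleC_prod :: "complex \<Rightarrow> 'a \<times> 'b \<Rightarrow> 'a \<times> 'b"
  where "scaleC_prod c x = (c *\<^sub>C fst x, c *\<^sub>C snd x)"

definition cinner_prod :: "'a \<times> 'b \<Rightarrow> 'a \<times> 'b \<Rightarrow> complex"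
  where "cinner_prod x y = cinner (fst x) (fst y) + cinner (snd x) (snd y)"

instance
proof
  fix x y :: "'a \<times> 'b"
  show "cinner x y = cnj (cinner y x)"
    unfolding cinner_prod_def
    by (metis cinner_commute complex_cnj_add)
  show "cinner x x = complex_of_real ((norm x)\<^sup>2)"
    by (simp add: cinner_prod_def cinner_self_norm norm_prod_def)
qed (simp_all add: scaleC_prod_def cinner_prod_def cinner_simps scaleC_add_left scaleC_add_right
       scaleC_scaleC scaleC_one scaleR_scaleC prod_eq_iff distrib_left)

end

lemma scaleC_Pair [simp]: "c *\<^sub>C (x, y) = (c *\<^sub>C x, c *\<^sub>C y)"
  by (simp add: scaleC_prod_def)

lemma cinner_Pair [simp]: "cinner (x, y) (u, v) = cinner x u + cinner y v"
  by (simp add: cinner_prod_def)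

section \<open>Closed subspaces and orthogonal projection\<close>

definition csubspace :: "'a::complex_hilbert set \<Rightarrow> bool" where
  "csubspace S \<longleftrightarrow> 0 \<in> S \<and> (\<forall>x\<in>S. \<forall>y\<in>S. x + y \<in> S) \<and> (\<forall>c. \<forall>x\<in>S. c *\<^sub>C x \<in> S)"

lemma csubspace_add: "csubspace S \<Longrightarrow> x \<in> S \<Longrightarrow> y \<in> S \<Longrightarrow> x + y \<in> S"
  and csubspace_scaleC: "csubspace S \<Longrightarrow> x \<in> S \<Longrightarrow> c *\<^sub>C x \<in> S"
  and csubspace_0: "csubspace S \<Longrightarrow> 0 \<in> S"
  by (simp_all add: csubspace_def)

lemma csubspace_minus: "csubspace S \<Longrightarrow> x \<in> S \<Longrightarrow> - x \<in> S"
  using csubspace_scaleC[of S x "-1"] by (simp add: scaleC_minus_one)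

lemma csubspace_diff: "csubspace S \<Longrightarrow> x \<in> S \<Longrightarrow> y \<in> S \<Longrightarrow> x - y \<in> S"
  using csubspace_add[of S x "- y"] csubspace_minus[of S y] by simp

lemma bounded_linear_scaleC: "bounded_linear (\<lambda>x::'a::complex_hilbert. c *\<^sub>C x)"
proof (rule bounded_linear_intro)
  show "norm (c *\<^sub>C x) \<le> norm x * cmod c" for x :: 'a
    by (simp add: norm_scaleC)
qed (simp_all add: scaleC_add_right scaleR_scaleC scaleC_scaleC mult.commute)

lemma csubspace_closure:
  assumes "csubspace S"
  shows "csubspace (closure S)"
  unfolding csubspace_def
proof (intro conjI ballI allI)
  show "0 \<in> closure S"
    using assms closure_subset by (auto simp: csubspace_def)
next
  fix x y assume "x \<in> closure S" "y \<in> closure S"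
  then obtain u v where "\<And>n. u n \<in> S" "u \<longlonglongrightarrow> x" "\<And>n. v n \<in> S" "v \<longlonglongrightarrow> y"
    unfolding closure_sequential by metis
  then show "x + y \<in> closure S"
    unfolding closure_sequential
    by (intro exI[of _ "\<lambda>n. u n + v n"]) (auto intro: tendsto_add csubspace_add[OF assms])
next
  fix c x assume "x \<in> closure S"
  then obtain u where "\<And>n. u n \<in> S" "u \<longlonglongrightarrow> x"
    unfolding closure_sequential by metis
  then show "c *\<^sub>C x \<in> closure S"
    unfolding closure_sequential
    by (intro exI[of _ "\<lambda>n. c *\<^sub>C u n"])
      (auto intro: bounded_linear.tendsto[OF bounded_linear_scaleC] csubspace_scaleC[OF assms])
qed

text \<open>A minimizing sequence is Cauchy by the parallelogram law: the midpoint of two members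
  lies in \<open>S\<close>, so its squared distance to \<open>x\<close> is at least the infimum
  \<open>e\<close>.\<close>

lemma nearest_point_exists:
  fixes S :: "'a::complex_hilbert set"
  assumes "closed S" and sub: "csubspace S"
  obtains p where "p \<in> S" "\<And>s. s \<in> S \<Longrightarrow> norm (x - p) \<le> norm (x - s)"
proof -
  define e where "e = (INF s\<in>S. (norm (x - s))\<^sup>2)"
  have bdd: "bdd_below ((\<lambda>s. (norm (x - s))\<^sup>2) ` S)"
    by (rule bdd_belowI2[of _ 0]) simp
  have ne: "S \<noteq> {}"
    using csubspace_0[OF sub] by auto
  have e_le: "e \<le> (norm (x - s))\<^sup>2" if "s \<in> S" for s
    unfolding e_def by (rule cINF_lower[OF bdd that])
  have "\<exists>s\<in>S. (norm (x - s))\<^sup>2 < e + 1 / real (Suc n)" for n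
    using cINF_less_iff[OF ne bdd, of "e + 1 / real (Suc n)"] by (auto simp: e_def[symmetric])
  then obtain s where s: "\<And>n. s n \<in> S" "\<And>n. (norm (x - s n))\<^sup>2 < e + 1 / real (Suc n)"
    by metis
  have gap: "(norm (s m - s n))\<^sup>2 \<le> 4 / real (Suc N)" if "N \<le> m" "N \<le> n" for m n N
  proof -
    define a where "a = x - s m"
    define b where "b = x - s n"
    have half: "(1/2) *\<^sub>C (s m + s n) \<in> S"
      by (intro csubspace_scaleC csubspace_add sub s)
    have "(2::complex) *\<^sub>C u = u + u" for u :: 'a
      using scaleC_add_left[of 1 1 u] by (simp add: scaleC_one)
    then have "a + b = 2 *\<^sub>C (x - (1/2) *\<^sub>C (s m + s n))"
      by (simp add: a_def b_def scaleC_diff_right scaleC_scaleC scaleC_one)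
    then have "(norm (a + b))\<^sup>2 \<ge> 4 * e"
      using e_le[OF half] by (simp add: norm_scaleC power_mult_distrib)
    moreover have "(norm (s m - s n))\<^sup>2 = (norm (a - b))\<^sup>2"
      by (simp add: a_def b_def norm_minus_commute)
    moreover have "(norm (a + b))\<^sup>2 + (norm (a - b))\<^sup>2 = 2 * (norm a)\<^sup>2 + 2 * (norm b)\<^sup>2"
      by (simp add: norm_add_square norm_diff_square)
    moreover have "1 / real (Suc m) \<le> 1 / real (Suc N)" "1 / real (Suc n) \<le> 1 / real (Suc N)"
      using that by (simp_all add: frac_le)
    ultimately show ?thesis
      using s(2)[of m] s(2)[of n] unfolding a_def b_def by linarith
  qed
  have "Cauchy s"
  proof (rule metric_CauchyI)
    fix r :: real assume r: "r > 0"
    obtain N where N: "4 / r\<^sup>2 < real (Suc N)"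
      using reals_Archimedean2 by (metis less_trans lessI of_nat_less_iff)
    then have "4 / real (Suc N) < r\<^sup>2"
      using r by (simp add: field_simps)
    then have "dist (s m) (s n) < r" if "N \<le> m" "N \<le> n" for m n
      using gap[OF that] r unfolding dist_norm
      by (meson le_less_trans power2_less_imp_less less_imp_le)
    then show "\<exists>M. \<forall>m\<ge>M. \<forall>n\<ge>M. dist (s m) (s n) < r"
      by blast
  qed
  then obtain p where p: "s \<longlonglongrightarrow> p"
    using Cauchy_convergent_iff convergent_def by blast
  have "p \<in> S"
    using assms(1) s(1) p closed_sequentially by blast
  have "(\<lambda>n. (norm (x - s n))\<^sup>2) \<longlonglongrightarrow> (norm (x - p))\<^sup>2"
    by (intro tendsto_intros p)
  moreover have "(\<lambda>n. e + 1 / real (Suc n)) \<longlonglongrightarrow> e + 0"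
    by (intro tendsto_intros LIMSEQ_Suc[OF lim_1_over_n])
  ultimately have "(norm (x - p))\<^sup>2 \<le> e"
    using s(2) by (intro LIMSEQ_le[where Y = "\<lambda>n. e + 1 / real (Suc n)"]) (auto intro: less_imp_le)
  then have "norm (x - p) \<le> norm (x - s)" if "s \<in> S" for s
    using e_le[OF that] by (meson order_trans power2_le_imp_le norm_ge_zero)
  with \<open>p \<in> S\<close> show ?thesis
    using that by blast
qed

text \<open>Moving the nearest point along \<open>s\<close> by the coefficient \<open>c\<close> of
  \<open>x - p\<close> would lower the squared distance by \<open>|a|^2 / |s|^2\<close>, hence
  \<open>a = 0\<close>.\<close>

lemma orthogonal_projection:
  fixes S :: "'a::complex_hilbert set"
  assumes "closed S" and sub: "csubspace S"
  obtains p where "p \<in> S" "\<And>s. s \<in> S \<Longrightarrow> cinner s (x - p) = 0"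
proof -
  obtain p where p: "p \<in> S" "\<And>s. s \<in> S \<Longrightarrow> norm (x - p) \<le> norm (x - s)"
    using nearest_point_exists[OF assms] by metis
  have "cinner s (x - p) = 0" if s: "s \<in> S" for s
  proof (cases "s = 0")
    case False
    define a where "a = cinner (x - p) s"
    define c where "c = a / complex_of_real ((norm s)\<^sup>2)"
    have ns: "norm s > 0"
      using False by simp
    have "p + c *\<^sub>C s \<in> S"
      by (intro csubspace_add csubspace_scaleC sub p s)
    then have "norm (x - p) \<le> norm (x - p - c *\<^sub>C s)"
      using p(2) by (metis diff_diff_add)
    then have "(norm (x - p))\<^sup>2 \<le> (norm (x - p - c *\<^sub>C s))\<^sup>2"
      by (simp add: power_mono)
    also have "\<dots> = (norm (x - p))\<^sup>2 + (cmod c * norm s)\<^sup>2 - 2 * Re (cnj c * a)"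
      by (subst norm_diff_square) (simp add: norm_scaleC cinner_scaleC_right a_def)
    finally have "2 * Re (cnj c * a) \<le> (cmod c * norm s)\<^sup>2"
      by simp
    moreover have "Re (cnj c * a) = (cmod a)\<^sup>2 / (norm s)\<^sup>2"
      by (simp add: c_def cmod_power2 add_divide_distrib flip: power2_eq_square of_real_power)
    moreover have "(cmod c * norm s)\<^sup>2 = (cmod a)\<^sup>2 / (norm s)\<^sup>2"
      using ns by (simp add: c_def norm_divide norm_mult norm_power power_mult_distrib power_divide
           field_simps power2_eq_square)
    ultimately have "(cmod a)\<^sup>2 / (norm s)\<^sup>2 \<le> 0"
      by simp
    then have "a = 0"
      using ns by (simp add: divide_le_0_iff)
    then show ?thesis
      by (metis a_def cinner_commute complex_cnj_zero)
  qed simp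
  with p(1) show ?thesis
    using that by blast
qed

section \<open>Bounded operators commuting with a positive operator\<close>

text \<open>The identity forces both maps to be linear (\<open>is_adjoint_linear\<close>), so it
  also serves as the linearity condition.\<close>

definition is_adjoint :: "('a::complex_hilbert \<Rightarrow> 'b::complex_hilbert) \<Rightarrow> ('b \<Rightarrow> 'a) \<Rightarrow> bool" where
  "is_adjoint F G \<longleftrightarrow> (\<forall>x y. cinner (F x) y = cinner x (G y))"

lemma is_adjointD: "is_adjoint F G \<Longrightarrow> cinner (F x) y = cinner x (G y)"
  by (simp add: is_adjoint_def)

lemma is_adjoint_swap: "is_adjoint F G \<Longrightarrow> is_adjoint G F"
  unfolding is_adjoint_def by (metis cinner_commute)

lemma is_adjoint_linear:
  assumes "is_adjoint F G"
  shows is_adjoint_add: "F (x + y) = F x + F y"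
    and is_adjoint_diff: "F (x - y) = F x - F y"
    and is_adjoint_scaleC: "F (c *\<^sub>C x) = c *\<^sub>C F x"
  by (rule cinner_eqI, simp add: cinner_simps is_adjointD[OF assms])+

lemma is_adjoint_funpow: "is_adjoint F F \<Longrightarrow> is_adjoint (F ^^ n) (F ^^ n)"
proof (induction n)
  case (Suc n)
  then show ?case
    by (simp add: is_adjoint_def funpow_swap1)
qed (simp add: is_adjoint_def)

text \<open>Lax's argument: \<open>Z = J G\<close> is symmetric for the form \<open>\<lambda>u v. cinner (D u) v\<close>, so
  \<open>\<phi> n = cinner (D (Z\<^sup>n x)) x\<close> satisfies \<open>(\<phi> n)\<^sup>2 \<le> \<phi> (2 n) \<phi> 0\<close>, whereas its growth rate is at
  most \<open>g b\<close>.\<close>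

lemma lax_bound:
  fixes D G Gs J :: "'a::complex_hilbert \<Rightarrow> 'a" and g b :: real
  assumes D: "is_adjoint D D" and pos: "\<And>x. 0 \<le> Re (cinner (D x) x)"
    and G: "is_adjoint G Gs" and Gs: "\<And>x. norm (Gs x) \<le> g * norm x"
    and J: "\<And>x. Gs (D x) = D (J x)"
    and b: "\<And>x. norm (D (G x)) \<le> b * norm (D x)"
    and g0: "0 \<le> g" and b0: "0 \<le> b"
  shows "Re (cinner (D (G x)) (G x)) \<le> g * b * Re (cinner (D x) x)"
proof -
  define Z where "Z u = J (G u)" for u
  have DZ: "D (Z u) = Gs (D (G u))" for u
    by (simp add: Z_def J)
  have sym1: "cinner (D (Z u)) v = cinner (D u) (Z v)" for u v
    by (metis DZ is_adjointD[OF D] is_adjointD[OF G] is_adjointD[OF is_adjoint_swap[OF G]])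
  have sym: "cinner (D ((Z ^^ n) u)) v = cinner (D u) ((Z ^^ n) v)" for n u v
  proof (induction n arbitrary: v)
    case (Suc n)
    then show ?case
      by (simp add: sym1) (simp add: funpow_swap1)
  qed simp
  define \<phi> where "\<phi> n = Re (cinner (D ((Z ^^ n) x)) x)" for n
  have dbl: "(\<phi> n)\<^sup>2 \<le> \<phi> (2 * n) * \<phi> 0" for n
  proof -
    have "(\<phi> n)\<^sup>2 \<le> (cmod (cinner (D ((Z ^^ n) x)) x))\<^sup>2"
      unfolding \<phi>_def using abs_Re_le_cmod by (metis abs_ge_zero power2_abs power_mono)
    also have "\<dots> \<le> Re (cinner (D ((Z ^^ n) x)) ((Z ^^ n) x)) * Re (cinner (D x) x)"
      by (rule cauchy_schwarz_form[OF is_adjointD[OF D] pos])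
    also have "cinner (D ((Z ^^ n) x)) ((Z ^^ n) x) = cinner (D ((Z ^^ (2 * n)) x)) x"
      by (simp add: sym[of n, symmetric] mult_2 funpow_add)
    finally show ?thesis
      by (simp add: \<phi>_def)
  qed
  have growth: "norm (D ((Z ^^ n) x)) \<le> (g * b) ^ n * norm (D x)" for n
  proof (induction n)
    case (Suc n)
    have "norm (D ((Z ^^ Suc n) x)) \<le> g * (b * norm (D ((Z ^^ n) x)))"
      using Gs[of "D (G ((Z ^^ n) x))"] b[of "(Z ^^ n) x"] g0
      by (simp add: DZ) (meson mult_left_mono order_trans)
    also have "\<dots> \<le> g * (b * ((g * b) ^ n * norm (D x)))"
      by (intro mult_left_mono Suc g0 b0)
    finally show ?case
      by (simp add: algebra_simps)
  qed simp
  have upper: "\<phi> n \<le> (g * b) ^ n * (norm (D x) * norm x)" for n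
  proof -
    have "\<phi> n \<le> norm (D ((Z ^^ n) x)) * norm x"
      unfolding \<phi>_def using complex_Re_le_cmod cauchy_schwarz by (rule order_trans)
    then show ?thesis
      using mult_right_mono[OF growth norm_ge_zero[of x]] by (simp add: mult.assoc order_trans)
  qed
  have "\<phi> 1 \<le> g * b * \<phi> 0"
  proof (rule ccontr)
    assume less: "\<not> \<phi> 1 \<le> g * b * \<phi> 0"
    have "\<phi> 0 \<ge> 0"
      using pos by (simp add: \<phi>_def)
    moreover have "\<phi> 0 \<noteq> 0"
      using dbl[of 1] less by auto
    ultimately have \<phi>0: "\<phi> 0 > 0"
      by simp
    define \<rho> where "\<rho> = \<phi> 1 / \<phi> 0"
    have \<rho>: "\<rho> > g * b"
      using less \<phi>0 by (simp add: \<rho>_def field_simps)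
    then have \<rho>0: "\<rho> > 0"
      using g0 b0 by (meson le_less_trans mult_nonneg_nonneg)
    \<comment> \<open>Iterated doubling from \<open>\<phi> 1 = \<rho> \<phi> 0\<close> gives growth
      at rate \<open>\<rho> > g b\<close>, which contradicts \<open>upper\<close>.\<close>
    have lower: "\<rho> ^ (2 ^ k) * \<phi> 0 \<le> \<phi> (2 ^ k)" for k
    proof (induction k)
      case 0
      then show ?case
        using \<phi>0 by (simp add: \<rho>_def)
    next
      case (Suc k)
      have "(\<rho> ^ (2 ^ k) * \<phi> 0)\<^sup>2 \<le> (\<phi> (2 ^ k))\<^sup>2"
        using \<phi>0 \<rho>0 by (intro power_mono Suc) simp
      also have "\<dots> \<le> \<phi> (2 ^ Suc k) * \<phi> 0"
        using dbl[of "2 ^ k"] by simp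
      finally have "(\<rho> ^ (2 ^ Suc k) * \<phi> 0) * \<phi> 0 \<le> \<phi> (2 ^ Suc k) * \<phi> 0"
        by (simp add: power_mult_distrib power2_eq_square mult_2 power_add algebra_simps)
      then show ?case
        using \<phi>0 by simp
    qed
    define q where "q = g * b / \<rho>"
    have q: "0 \<le> q" "q < 1"
      using \<rho> \<rho>0 g0 b0 by (simp_all add: q_def)
    have "\<phi> 0 \<le> q ^ (2 ^ k) * (norm (D x) * norm x)" for k
      using lower[of k] upper[of "2 ^ k"] \<rho>0 by (simp add: q_def power_divide field_simps)
    moreover have "(\<lambda>k::nat. q ^ (2 ^ k) * (norm (D x) * norm x)) \<longlonglongrightarrow> 0 * (norm (D x) * norm x)"
    proof (intro tendsto_mult_right)
      have "strict_mono (\<lambda>k::nat. 2 ^ k :: nat)"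
        by (simp add: strict_mono_def)
      then show "(\<lambda>k::nat. q ^ (2 ^ k)) \<longlonglongrightarrow> 0"
        using LIMSEQ_subseq_LIMSEQ[OF LIMSEQ_realpow_zero[OF q]] by (simp add: o_def)
    qed
    ultimately have "\<phi> 0 \<le> 0"
      by (simp add: LIMSEQ_le_const)
    with \<phi>0 show False
      by simp
  qed
  moreover have "\<phi> 1 = Re (cinner (D (G x)) (G x))"
    by (simp add: \<phi>_def DZ is_adjointD[OF is_adjoint_swap[OF G]])
  ultimately show ?thesis
    by (simp add: \<phi>_def)
qed

text \<open>The uniform constant \<open>c\<close> self-improves to the operator norm: \<open>lax_bound\<close> with
  \<open>D = W\<^sup>2\<^sup>m\<close> turns a bound \<open>b\<close> that is valid for all powers into \<open>sqrt (g b)\<close>.\<close>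

lemma power_bound_improves:
  fixes W G Gs :: "'a::complex_hilbert \<Rightarrow> 'a" and g c :: real
  assumes W: "is_adjoint W W" and pos: "\<And>x. 0 \<le> Re (cinner (W x) x)"
    and G: "is_adjoint G Gs" and Gs: "\<And>x. norm (Gs x) \<le> g * norm x" and g0: "0 \<le> g"
    and J: "\<And>m x. \<exists>y. Gs ((W ^^ m) x) = (W ^^ m) y"
    and c: "\<And>m x. norm ((W ^^ m) (G x)) \<le> c * norm ((W ^^ m) x)" and c0: "0 \<le> c"
  shows "Re (cinner (W (G x)) (G x)) \<le> g\<^sup>2 * Re (cinner (W x) x)"
proof -
  \<comment> \<open>\<open>S\<close> collects the admissible constants; its infimum
    \<open>\<beta>\<close> turns out to be admissible as well.\<close>
  define S where "S = {b. 0 \<le> b \<and> (\<forall>m x. norm ((W ^^ m) (G x)) \<le> b * norm ((W ^^ m) x))}"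
  define \<beta> where "\<beta> = Inf S"
  have cS: "c \<in> S"
    using c c0 by (simp add: S_def)
  have bdd: "bdd_below S"
    by (rule bdd_belowI[of _ 0]) (simp add: S_def)
  have \<beta>0: "0 \<le> \<beta>"
    unfolding \<beta>_def using cS by (intro cInf_greatest) (auto simp: S_def)
  have \<beta>: "norm ((W ^^ m) (G x)) \<le> \<beta> * norm ((W ^^ m) x)" for m x
  proof (cases "norm ((W ^^ m) x) = 0")
    case True
    then show ?thesis
      using c[of m x] by simp
  next
    case False
    then have "norm ((W ^^ m) (G x)) / norm ((W ^^ m) x) \<le> b" if "b \<in> S" for b
      using that by (simp add: S_def divide_le_eq)
    then have "norm ((W ^^ m) (G x)) / norm ((W ^^ m) x) \<le> \<beta>"
      unfolding \<beta>_def using cS by (intro cInf_greatest) auto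
    then show ?thesis
      using False by (simp add: divide_le_eq)
  qed
  have lax: "Re (cinner ((W ^^ n) (G x)) (G x)) \<le> g * \<beta> * Re (cinner ((W ^^ n) x) x)"
    if "\<And>x. 0 \<le> Re (cinner ((W ^^ n) x) x)" for n x
  proof -
    obtain K where "\<And>x. Gs ((W ^^ n) x) = (W ^^ n) (K x)"
      using J[of n] by metis
    then show ?thesis
      using that by (intro lax_bound[OF is_adjoint_funpow[OF W] _ G Gs _ \<beta> g0 \<beta>0])
  qed
  have sq: "Re (cinner ((W ^^ (m + m)) x) x) = (norm ((W ^^ m) x))\<^sup>2" for m x
    using is_adjointD[OF is_adjoint_funpow[OF W], of m "(W ^^ m) x" x]
    by (simp add: funpow_add Re_cinner_self)
  \<comment> \<open>Even powers of \<open>W\<close> are positive forms, so \<open>lax\<close>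
    applies to them without further conditions. Minimality of \<open>\<beta>\<close> then gives
    \<open>\<beta> \<le> sqrt (g \<beta>)\<close>, hence \<open>\<beta> \<le> g\<close>.\<close>
  have "sqrt (g * \<beta>) \<in> S"
    unfolding S_def
  proof (intro CollectI conjI allI)
    show "0 \<le> sqrt (g * \<beta>)"
      using g0 \<beta>0 by simp
  next
    fix m x
    have "(norm ((W ^^ m) (G x)))\<^sup>2 \<le> g * \<beta> * (norm ((W ^^ m) x))\<^sup>2"
      using lax[of "m + m" x] by (simp only: sq) simp
    also have "\<dots> = (sqrt (g * \<beta>) * norm ((W ^^ m) x))\<^sup>2"
      using g0 \<beta>0 by (simp add: power_mult_distrib)
    finally show "norm ((W ^^ m) (G x)) \<le> sqrt (g * \<beta>) * norm ((W ^^ m) x)"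
      by (rule power2_le_imp_le) (use g0 \<beta>0 in simp)
  qed
  then have "\<beta> \<le> sqrt (g * \<beta>)"
    unfolding \<beta>_def using bdd by (rule cInf_lower)
  then have "\<beta> * \<beta> \<le> g * \<beta>"
    using power_mono[OF _ \<beta>0, of "sqrt (g * \<beta>)" 2] \<beta>0 g0 by (simp add: power2_eq_square)
  then have "\<beta> \<le> g"
    using \<beta>0 g0 by (cases "\<beta> = 0") auto
  have "Re (cinner (W (G x)) (G x)) \<le> g * \<beta> * Re (cinner (W x) x)"
    using lax[of 1 x] pos by simp
  also have "\<dots> \<le> g * g * Re (cinner (W x) x)"
    using \<open>\<beta> \<le> g\<close> g0 pos by (intro mult_right_mono mult_left_mono) auto
  finally show ?thesis
    by (simp add: power2_eq_square)
qed

text \<open>The estimate of \<open>power_bound_improves\<close> for all the normal operators \<open>V + i \<alpha>\<close> forces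
  \<open>cinner (W (V x)) x\<close> to be real, that is, \<open>W V\<close> to be symmetric.\<close>

lemma commute_of_power_bound:
  fixes W V :: "'a::complex_hilbert \<Rightarrow> 'a" and v c :: real
  assumes W: "is_adjoint W W" and pos: "\<And>x. 0 \<le> Re (cinner (W x) x)"
    and V: "is_adjoint V V" and v: "\<And>x. norm (V x) \<le> v * norm x"
    and J: "\<And>m x. \<exists>y. V ((W ^^ m) x) = (W ^^ m) y"
    and c: "\<And>m x. norm ((W ^^ m) (V x)) \<le> c * norm ((W ^^ m) x)" and c0: "0 \<le> c"
  shows "W (V x) = V (W x)"
proof -
  \<comment> \<open>\<open>cinner (V x) x\<close> is real, so the cross term with
    \<open>i \<alpha> x\<close> has real part 0.\<close>
  have norm_G: "norm (V x + (\<i> * complex_of_real \<alpha>) *\<^sub>C x) \<le> sqrt (v\<^sup>2 + \<alpha>\<^sup>2) * norm x" for \<alpha> x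
  proof (rule power2_le_imp_le)
    have "Im (cinner (V x) x) = 0"
      using is_adjointD[OF V, of x x] cinner_commute[of x "V x"] by (simp add: complex_eq_iff)
    then have "(norm (V x + (\<i> * complex_of_real \<alpha>) *\<^sub>C x))\<^sup>2 = (norm (V x))\<^sup>2 + \<alpha>\<^sup>2 * (norm x)\<^sup>2"
      by (simp add: norm_add_square norm_scaleC norm_mult power_mult_distrib cinner_scaleC_right)
    also have "\<dots> \<le> v\<^sup>2 * (norm x)\<^sup>2 + \<alpha>\<^sup>2 * (norm x)\<^sup>2"
      using power_mono[OF v[of x] norm_ge_zero, of 2] by (simp add: power_mult_distrib)
    also have "\<dots> = (sqrt (v\<^sup>2 + \<alpha>\<^sup>2) * norm x)\<^sup>2"
      by (simp add: power_mult_distrib algebra_simps)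
    finally show "(norm (V x + (\<i> * complex_of_real \<alpha>) *\<^sub>C x))\<^sup>2 \<le> (sqrt (v\<^sup>2 + \<alpha>\<^sup>2) * norm x)\<^sup>2" .
  qed simp
  \<comment> \<open>The terms in \<open>\<alpha>^2\<close> cancel. The remaining bound is affine in
    \<open>\<alpha>\<close>, so it can hold for all \<open>\<alpha>\<close> only if the slope
    vanishes.\<close>
  have ineq: "Re (cinner (W (V x)) (V x)) + 2 * \<alpha> * Im (cinner (W (V x)) x)
      \<le> v\<^sup>2 * Re (cinner (W x) x)" for \<alpha> :: real and x
  proof -
    let ?a = "\<i> * complex_of_real \<alpha>"
    define G where "G x = V x + ?a *\<^sub>C x" for x
    define Gs where "Gs x = V x + (- ?a) *\<^sub>C x" for x
    note Wm = is_adjoint_funpow[OF W]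
    have "Re (cinner (W (G x)) (G x)) \<le> (sqrt (v\<^sup>2 + \<alpha>\<^sup>2))\<^sup>2 * Re (cinner (W x) x)"
    proof (rule power_bound_improves[OF W pos, of G Gs _ "c + \<bar>\<alpha>\<bar>"])
      show "is_adjoint G Gs"
        by (simp add: is_adjoint_def G_def Gs_def cinner_simps is_adjointD[OF V])
      show "norm (Gs x) \<le> sqrt (v\<^sup>2 + \<alpha>\<^sup>2) * norm x" for x
        using norm_G[of x "- \<alpha>"] by (simp add: Gs_def)
      show "\<exists>y. Gs ((W ^^ m) x) = (W ^^ m) y" for m x
      proof -
        obtain y where "V ((W ^^ m) x) = (W ^^ m) y"
          using J by blast
        then have "Gs ((W ^^ m) x) = (W ^^ m) (y + (- ?a) *\<^sub>C x)"
          by (simp add: Gs_def is_adjoint_add[OF Wm] is_adjoint_scaleC[OF Wm])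
        then show ?thesis ..
      qed
      show "norm ((W ^^ m) (G x)) \<le> (c + \<bar>\<alpha>\<bar>) * norm ((W ^^ m) x)" for m x
        unfolding G_def is_adjoint_add[OF Wm] is_adjoint_scaleC[OF Wm]
        using norm_triangle_ineq[of "(W ^^ m) (V x)" "?a *\<^sub>C (W ^^ m) x"] c[of m x]
        by (simp add: norm_scaleC norm_mult distrib_right)
    qed (use c0 in auto)
    moreover have "W (G x) = W (V x) + ?a *\<^sub>C W x"
      by (simp add: G_def is_adjoint_add[OF W] is_adjoint_scaleC[OF W])
    moreover have "cinner (W x) (V x) = cnj (cinner (W (V x)) x)"
      by (metis cinner_commute is_adjointD[OF W])
    ultimately show ?thesis
      by (simp add: G_def cinner_simps algebra_simps power2_eq_square)
  qed
  have "Im (cinner (W (V x)) x) = 0" for x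
  proof (rule ccontr)
    define t where "t = Im (cinner (W (V x)) x)"
    define r where "r = v\<^sup>2 * Re (cinner (W x) x) - Re (cinner (W (V x)) (V x))"
    assume "Im (cinner (W (V x)) x) \<noteq> 0"
    then have "t \<noteq> 0"
      by (simp add: t_def)
    then have "2 * ((r + 1) / (2 * t)) * t = r + 1"
      by simp
    then show False
      using ineq[of x "(r + 1) / (2 * t)"] unfolding t_def[symmetric] r_def by linarith
  qed
  then have real: "cinner (W (V x)) x = cnj (cinner (W (V x)) x)" for x
    by (simp add: complex_eq_iff)
  define E where "E x = W (V x) - V (W x)" for x
  have E0: "cinner (E x) x = 0" for x
    using real[of x] unfolding E_def cinner_diff_left
    by (metis cinner_commute eq_iff_diff_eq_0 is_adjointD[OF V] is_adjointD[OF W])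
  have Elin: "E (x + c *\<^sub>C y) = E x + c *\<^sub>C E y" for c x y
    by (simp add: E_def is_adjoint_add[OF V] is_adjoint_add[OF W] is_adjoint_scaleC[OF V]
        is_adjoint_scaleC[OF W] scaleC_diff_right)
  \<comment> \<open>Polarization: the vanishing quadratic form of \<open>E\<close> is tested at
    \<open>x + y\<close> and at \<open>x + i y\<close>.\<close>
  have "cinner (E x) y = 0" for x y
  proof -
    have "cinner (E x) y + cinner (E y) x = 0"
      using E0[of "x + 1 *\<^sub>C y"] E0[of x] E0[of y]
      by (simp only: Elin) (simp add: cinner_simps scaleC_one add.commute)
    moreover have "- \<i> * cinner (E x) y + \<i> * cinner (E y) x = 0"
      using E0[of "x + \<i> *\<^sub>C y"] E0[of x] E0[of y]
      by (simp only: Elin) (simp add: cinner_simps)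
    ultimately show ?thesis
      by (simp add: complex_eq_iff)
  qed
  then have "E x = 0"
    using cinner_eqI[of "E x" 0] by simp
  then show ?thesis
    by (simp add: E_def)
qed

section \<open>Closed operators and their adjoints\<close>

definition graph_on :: "'a set \<Rightarrow> ('a \<Rightarrow> 'b) \<Rightarrow> ('a \<times> 'b) set" where
  "graph_on D f = (\<lambda>x. (x, f x)) ` D"

lemma graph_on_iff [simp]: "(x, y) \<in> graph_on D f \<longleftrightarrow> x \<in> D \<and> f x = y"
  by (auto simp: graph_on_def)

lemma graph_on_linear:
  assumes "csubspace (graph_on D f)"
  shows graph_on_0: "0 \<in> D" "f 0 = 0"
    and graph_on_add: "x \<in> D \<Longrightarrow> y \<in> D \<Longrightarrow> x + y \<in> D" "x \<in> D \<Longrightarrow> y \<in> D \<Longrightarrow> f (x + y) = f x + f y"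
    and graph_on_diff: "x \<in> D \<Longrightarrow> y \<in> D \<Longrightarrow> x - y \<in> D" "x \<in> D \<Longrightarrow> y \<in> D \<Longrightarrow> f (x - y) = f x - f y"
    and graph_on_scaleC: "x \<in> D \<Longrightarrow> c *\<^sub>C x \<in> D" "x \<in> D \<Longrightarrow> f (c *\<^sub>C x) = c *\<^sub>C f x"
    and graph_on_minus: "x \<in> D \<Longrightarrow> - x \<in> D" "x \<in> D \<Longrightarrow> f (- x) = - f x"
  using csubspace_0[OF assms] csubspace_add[OF assms, of "(x, f x)" "(y, f y)"]
    csubspace_diff[OF assms, of "(x, f x)" "(y, f y)"]
    csubspace_scaleC[OF assms, of "(x, f x)" c] csubspace_minus[OF assms, of "(x, f x)"]
  by (simp_all add: zero_prod_def)

lemma graph_on_csubspaceI: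
  assumes "0 \<in> D" and "\<And>x y. x \<in> D \<Longrightarrow> y \<in> D \<Longrightarrow> x + y \<in> D \<and> f (x + y) = f x + f y"
    and scale: "\<And>c x. x \<in> D \<Longrightarrow> c *\<^sub>C x \<in> D \<and> f (c *\<^sub>C x) = c *\<^sub>C f x"
  shows "csubspace (graph_on D f)"
proof -
  have "f 0 = 0"
    using scale[OF assms(1), of 0] by simp
  with assms show ?thesis
    by (auto simp: csubspace_def graph_on_def zero_prod_def image_iff)
qed

text \<open>Project \<open>(u, v)\<close> onto the closed graph. By \<open>max\<close>, the
  remainder, being orthogonal to the graph, has the form \<open>(- g y, y)\<close>.\<close>

lemma von_neumann_decomposition:
  assumes "csubspace (graph_on D f)" and "closed (graph_on D f)"
    and max: "\<And>y z. (\<And>x. x \<in> D \<Longrightarrow> cinner (f x) y = cinner x z) \<Longrightarrow> y \<in> E \<and> g y = z"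
  obtains x y where "x \<in> D" "y \<in> E" "u = x - g y" "v = f x + y"
proof -
  obtain p where p: "p \<in> graph_on D f" "\<And>s. s \<in> graph_on D f \<Longrightarrow> cinner s ((u, v) - p) = 0"
    using orthogonal_projection[OF assms(2,1)] by metis
  then obtain x where x: "x \<in> D" "p = (x, f x)"
    by (auto simp: graph_on_def)
  have "cinner (f t) (v - f x) = cinner t (x - u)" if "t \<in> D" for t
    using p(2)[of "(t, f t)"] that x(2) by (simp add: cinner_diff_right algebra_simps)
  then have "v - f x \<in> E" "g (v - f x) = x - u"
    using max by blast+
  with x(1) show ?thesis
    using that[of x "v - f x"] by simp
qed

text \<open>A closed operator with domain \<open>D\<close> and action \<open>f\<close>, together with its adjoint, which has
  domain \<open>E\<close> and action \<open>g\<close>. The values of \<open>f\<close> and \<open>g\<close> outside these domains are irrelevant.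
  Linearity, density and closedness follow from the two maximality conditions.\<close>

locale adjoint_pair =
  fixes D :: "'a::complex_hilbert set" and f :: "'a \<Rightarrow> 'a" and E :: "'a set" and g :: "'a \<Rightarrow> 'a"
  assumes adj: "x \<in> D \<Longrightarrow> y \<in> E \<Longrightarrow> cinner (f x) y = cinner x (g y)"
    and max_right: "(\<And>x. x \<in> D \<Longrightarrow> cinner (f x) y = cinner x z) \<Longrightarrow> y \<in> E \<and> g y = z"
    and max_left: "(\<And>y. y \<in> E \<Longrightarrow> cinner (g y) x = cinner y z) \<Longrightarrow> x \<in> D \<and> f x = z"

text \<open>This is \<open>T\<^sup>*\<^sup>* = T\<close> for closed \<open>T\<close>: split
  \<open>(x, z)\<close> along the graph; the orthogonal part \<open>(- g q, q)\<close> satisfies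
  \<open>|g q|^2 + |q|^2 = 0\<close>.\<close>

lemma adjoint_pair_of_closed:
  assumes sub: "csubspace (graph_on D f)" and cl: "closed (graph_on D f)"
    and adj: "\<And>x y. x \<in> D \<Longrightarrow> y \<in> E \<Longrightarrow> cinner (f x) y = cinner x (g y)"
    and max: "\<And>y z. (\<And>x. x \<in> D \<Longrightarrow> cinner (f x) y = cinner x z) \<Longrightarrow> y \<in> E \<and> g y = z"
  shows "adjoint_pair D f E g"
proof
  fix x z assume xz: "\<And>y. y \<in> E \<Longrightarrow> cinner (g y) x = cinner y z"
  obtain t q where t: "t \<in> D" and q: "q \<in> E" and eq: "x = t - g q" "z = f t + q"
    using von_neumann_decomposition[OF sub cl max] by metis
  have "cinner (g q) t = cinner q (f t)"
    using adj[OF t q] cinner_commute by metis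
  then have "- cinner (g q) (g q) = cinner q q"
    using xz[OF q] by (simp add: eq cinner_simps)
  then have "cinner (g q) (g q) + cinner q q = 0"
    by (metis add.right_inverse)
  then have "complex_of_real ((norm (g q))\<^sup>2 + (norm q)\<^sup>2) = 0"
    by (simp add: cinner_self_norm)
  then have "g q = 0 \<and> q = 0"
    unfolding of_real_eq_0_iff sum_power2_eq_zero_iff norm_eq_zero .
  then have "g q = 0" "q = 0"
    by blast+
  with t eq show "x \<in> D \<and> f x = z"
    by simp
next
  show "cinner (f x) y = cinner x (g y)" if "x \<in> D" "y \<in> E" for x y
    using that by (rule adj)
  show "y \<in> E \<and> g y = z" if "\<And>x. x \<in> D \<Longrightarrow> cinner (f x) y = cinner x z" for y z
    using that by (rule max)
qed

section \<open>The everywhere defined inverse of \<open>1 + T\<^sup>* T\<close>\<close>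

definition resolvent ::
  "'a::complex_hilbert set \<Rightarrow> ('a \<Rightarrow> 'a) \<Rightarrow> 'a set \<Rightarrow> ('a \<Rightarrow> 'a) \<Rightarrow> 'a \<Rightarrow> 'a" where
  "resolvent D f E g u = (THE x. x \<in> D \<and> f x \<in> E \<and> x + g (f x) = u)"

context adjoint_pair
begin

lemma swap: "adjoint_pair E g D f"
proof
  show "cinner (g y) x = cinner y (f x)" if "y \<in> E" "x \<in> D" for x y
    using adj[OF that(2,1)] cinner_commute by metis
  show "x \<in> D \<and> f x = z" if "\<And>y. y \<in> E \<Longrightarrow> cinner (g y) x = cinner y z" for x z
    using that by (rule max_left)
  show "y \<in> E \<and> g y = z" if "\<And>x. x \<in> D \<Longrightarrow> cinner (f x) y = cinner x z" for y z
    using that by (rule max_right)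
qed



text \<open>By \<open>max_right\<close> at \<open>y = 0\<close>, a vector orthogonal to
  \<open>D\<close> equals \<open>g 0\<close>, and so does 0.\<close>

lemma orthogonal_to_domain:
  assumes "\<And>x. x \<in> D \<Longrightarrow> cinner x z = 0"
  shows "z = 0"
proof -
  have "g 0 = z"
    using max_right[of 0 z] assms by simp
  moreover have "g 0 = 0"
    using max_right[of 0 0] by simp
  ultimately show ?thesis
    by simp
qed

text \<open>Maximality turns the graph into the orthogonal complement of all
  \<open>(g y, - y)\<close>, from which subspace and closedness are immediate.\<close>

lemma graph_eq: "graph_on D f = {p. \<forall>y\<in>E. cinner (g y) (fst p) = cinner y (snd p)}"
proof (rule set_eqI)
  fix p :: "'a \<times> 'a"
  have "p \<in> graph_on D f \<longleftrightarrow> fst p \<in> D \<and> f (fst p) = snd p"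
    by (metis graph_on_iff prod.collapse)
  also have "\<dots> \<longleftrightarrow> (\<forall>y\<in>E. cinner (g y) (fst p) = cinner y (snd p))"
    using adjoint_pair.adj[OF swap] max_left by metis
  finally show "p \<in> graph_on D f \<longleftrightarrow> p \<in> {p. \<forall>y\<in>E. cinner (g y) (fst p) = cinner y (snd p)}"
    by simp
qed

lemma csubspace_graph: "csubspace (graph_on D f)"
  unfolding graph_eq by (auto simp: csubspace_def cinner_simps scaleC_prod_def)

lemma closed_graph: "closed (graph_on D f)"
proof -
  have "graph_on D f = (\<Inter>y\<in>E. {p. cinner (g y) (fst p) = cinner y (snd p)})"
    unfolding graph_eq by auto
  moreover have "closed {p. cinner (g y) (fst p) = cinner y (snd p)}" for y
    by (intro closed_Collect_eq linear_continuous_on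
        bounded_linear_compose[OF bounded_linear_cinner_right] bounded_linear_fst bounded_linear_snd)
  ultimately show ?thesis
    by (simp add: closed_INT)
qed

lemmas linear = graph_on_linear[OF csubspace_graph]

lemma inner_adj_self: "x \<in> D \<Longrightarrow> f x \<in> E \<Longrightarrow> cinner x (g (f x)) = cinner (f x) (f x)"
  by (simp add: adj)

lemma resolvent_unique:
  assumes "x \<in> D" "f x \<in> E" "y \<in> D" "f y \<in> E" and eq: "x + g (f x) = y + g (f y)"
  shows "x = y"
proof -
  interpret swap: adjoint_pair E g D f
    by (rule swap)
  define d where "d = x - y"
  have d: "d \<in> D" "f d \<in> E" "d + g (f d) = 0"
    using assms by (simp_all add: d_def linear swap.linear algebra_simps)
  then have "cinner d d + cinner d (g (f d)) = 0"
    by (simp flip: cinner_add_right)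
  then have "complex_of_real ((norm d)\<^sup>2 + (norm (f d))\<^sup>2) = 0"
    using d by (simp add: inner_adj_self cinner_self_norm)
  then show ?thesis
    unfolding of_real_eq_0_iff by (simp add: d_def sum_power2_eq_zero_iff)
qed

lemma resolvent_eqI:
  assumes "x \<in> D" "f x \<in> E" "x + g (f x) = u"
  shows "resolvent D f E g u = x"
  unfolding resolvent_def using assms resolvent_unique by (intro the_equality) auto

lemma resolvent:
  shows resolvent_mem: "resolvent D f E g u \<in> D" "f (resolvent D f E g u) \<in> E"
    and resolvent_eq: "resolvent D f E g u + g (f (resolvent D f E g u)) = u"
proof -
  interpret swap: adjoint_pair E g D f
    by (rule swap)
  \<comment> \<open>Decomposing \<open>(u, 0)\<close> along the graph and its complement solves the
    resolvent equation.\<close>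
  obtain x y where xy: "x \<in> D" "y \<in> E" "u = x - g y" "0 = f x + y"
    using von_neumann_decomposition[OF csubspace_graph closed_graph max_right] by metis
  then have "f x = - y"
    by (simp add: eq_neg_iff_add_eq_0)
  with xy have x: "x \<in> D" "f x \<in> E" "x + g (f x) = u"
    by (simp_all add: swap.linear)
  from x show "resolvent D f E g u \<in> D" "f (resolvent D f E g u) \<in> E"
    "resolvent D f E g u + g (f (resolvent D f E g u)) = u"
    by (simp_all add: resolvent_eqI[OF x])
qed

text \<open>The right-hand side is Hermitian in \<open>u\<close> and \<open>v\<close> and
  nonnegative on the diagonal; self-adjointness and positivity are read off from it.\<close>

lemma resolvent_inner:
  "cinner (resolvent D f E g u) v = cinner (resolvent D f E g u) (resolvent D f E g v)
     + cinner (f (resolvent D f E g u)) (f (resolvent D f E g v))"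
  using adj[OF resolvent_mem(1)[of u] resolvent_mem(2)[of v]]
  by (metis cinner_add_right resolvent_eq)

lemma resolvent_self_adjoint: "is_adjoint (resolvent D f E g) (resolvent D f E g)"
  unfolding is_adjoint_def
proof (intro allI)
  fix u v
  show "cinner (resolvent D f E g u) v = cinner u (resolvent D f E g v)"
    using resolvent_inner[of u v] resolvent_inner[of v u]
    by (metis cinner_commute complex_cnj_add)
qed

lemma resolvent_pos: "0 \<le> Re (cinner (resolvent D f E g u) u)"
  by (subst resolvent_inner) (simp add: Re_cinner_self)

lemma resolvent_eq_0_iff: "resolvent D f E g u = 0 \<longleftrightarrow> u = 0"
proof
  interpret swap: adjoint_pair E g D f
    by (rule swap)
  show "u = 0" if "resolvent D f E g u = 0"
    using resolvent_eq[of u] that by (simp add: linear swap.linear)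
  show "resolvent D f E g u = 0" if "u = 0"
    using that by (intro resolvent_eqI) (simp_all add: linear swap.linear)
qed

lemma resolvent_strict_pos: "Re (cinner (resolvent D f E g u) u) = 0 \<Longrightarrow> u = 0"
  by (subst (asm) resolvent_inner)
    (simp add: Re_cinner_self sum_power2_eq_zero_iff resolvent_eq_0_iff)

text \<open>Apply \<open>f\<close> to \<open>u + g (f u) = x\<close>, which is possible because
  \<open>g (f u) = x - u\<close> lies in \<open>D\<close>. The resolvents are those of
  \<open>T\<^sup>* T\<close> and of \<open>T T\<^sup>*\<close>.\<close>

lemma resolvent_commute:
  assumes "x \<in> D"
  shows "f (resolvent D f E g x) = resolvent E g D f (f x)"
proof -
  interpret swap: adjoint_pair E g D f
    by (rule swap)
  define u where "u = resolvent D f E g x"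
  have u: "u \<in> D" "f u \<in> E" "u + g (f u) = x"
    by (simp_all add: u_def resolvent_mem resolvent_eq)
  then have gfu: "g (f u) = x - u"
    by (simp add: algebra_simps)
  have "f u + f (g (f u)) = f x"
    using u(1) assms by (simp add: gfu linear)
  then have "resolvent E g D f (f x) = f u"
    using u assms gfu by (intro swap.resolvent_eqI) (simp_all add: linear)
  then show ?thesis
    by (simp add: u_def)
qed

end

text \<open>Since \<open>R\<close> commutes with \<open>f\<close> and is strictly positive, \<open>D0\<close> is a core: if \<open>(w, f w)\<close> is
  orthogonal to the graph of \<open>f\<close> on \<open>D0\<close>, then \<open>cinner (R w) w + cinner (R (f w)) (f w) = 0\<close>.
  The equality of norms therefore extends from \<open>D0\<close> to \<open>D\<close>.\<close>

lemma core_transfer: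
  fixes D D0 E :: "'a::complex_hilbert set" and f g R :: "'a \<Rightarrow> 'a"
  assumes subf: "csubspace (graph_on D f)" and clf: "closed (graph_on D f)"
    and subg: "csubspace (graph_on E g)" and clg: "closed (graph_on E g)"
    and D0: "csubspace D0" "D0 \<subseteq> D" "D0 \<subseteq> E"
    and norm_eq: "\<And>u. u \<in> D0 \<Longrightarrow> norm (f u) = norm (g u)"
    and R: "\<And>w. w \<in> D \<Longrightarrow> R w \<in> D0" "\<And>w. w \<in> D \<Longrightarrow> f (R w) = R (f w)"
    and pos: "\<And>w. 0 \<le> Re (cinner (R w) w)" "\<And>w. Re (cinner (R w) w) = 0 \<Longrightarrow> w = 0"
    and x: "x \<in> D"
  shows "x \<in> E \<and> norm (f x) = norm (g x)"
proof -
  note linf = graph_on_linear[OF subf] and ling = graph_on_linear[OF subg]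
  define L where "L = closure (graph_on D0 f)"
  have "csubspace (graph_on D0 f)"
    using D0 by (intro graph_on_csubspaceI) (auto simp: csubspace_def subset_iff linf)
  then have L: "csubspace L" "closed L"
    by (simp_all add: L_def csubspace_closure)
  have LD: "L \<subseteq> graph_on D f"
    unfolding L_def using D0(2) by (intro closure_minimal clf) (auto simp: graph_on_def)
  obtain p where p: "p \<in> L" "\<And>s. s \<in> L \<Longrightarrow> cinner s ((x, f x) - p) = 0"
    using orthogonal_projection[OF L(2,1)] by metis
  then obtain y where y: "y \<in> D" "p = (y, f y)"
    using LD by (auto simp: graph_on_def)
  define w where "w = x - y"
  have w: "w \<in> D" "(x, f x) - p = (w, f w)"
    using x y by (simp_all add: w_def linf)
  have "(R w, f (R w)) \<in> L"
    unfolding L_def using R(1)[OF w(1)] closure_subset by (force simp: graph_on_def)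
  from p(2)[OF this] have "cinner (R w) w + cinner (R (f w)) (f w) = 0"
    by (simp add: w R(2))
  then have "Re (cinner (R w) w) + Re (cinner (R (f w)) (f w)) = 0"
    by (metis plus_complex.sel(1) zero_complex.sel(1))
  then have "w = 0"
    using pos by (intro pos(2)) (meson add_nonneg_eq_0_iff)
  then have "(x, f x) \<in> closure (graph_on D0 f)"
    using p(1) y by (simp add: L_def w_def)
  then obtain s where s: "\<And>n. s n \<in> graph_on D0 f" "s \<longlonglongrightarrow> (x, f x)"
    unfolding closure_sequential by blast
  define u where "u n = fst (s n)" for n
  have s_eq: "s n = (u n, f (u n))" and u: "u n \<in> D0" for n
    using s(1)[of n] by (auto simp: u_def graph_on_def)
  have ux: "u \<longlonglongrightarrow> x" and fx: "(\<lambda>n. f (u n)) \<longlonglongrightarrow> f x"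
    using tendsto_fst[OF s(2)] tendsto_snd[OF s(2)] by (simp_all add: s_eq)
  have uD: "u n \<in> D" and uE: "u n \<in> E" for n
    using u D0 by auto
  \<comment> \<open>Norm equality on differences makes \<open>g (u n)\<close> Cauchy along with
    \<open>f (u n)\<close>; closedness of \<open>g\<close> then puts \<open>x\<close> into
    \<open>E\<close>.\<close>
  have "dist (g (u m)) (g (u n)) = dist (f (u m)) (f (u n))" for m n
    using norm_eq[OF csubspace_diff[OF D0(1) u u], of m n] uD uE
    by (simp add: dist_norm linf ling)
  then have "Cauchy (\<lambda>n. g (u n))"
    using LIMSEQ_imp_Cauchy[OF fx] by (simp add: Cauchy_def)
  then obtain z where z: "(\<lambda>n. g (u n)) \<longlonglongrightarrow> z"
    using Cauchy_convergent_iff convergent_def by blast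
  have lim: "(\<lambda>n. (u n, g (u n))) \<longlonglongrightarrow> (x, z)"
    by (intro tendsto_Pair ux z)
  have mem: "(u n, g (u n)) \<in> graph_on E g" for n
    using uE by simp
  have "(x, z) \<in> graph_on E g"
    by (rule closed_sequentially[OF clg mem lim])
  then have xE: "x \<in> E" "g x = z"
    by auto
  have "(\<lambda>n. norm (f (u n))) \<longlonglongrightarrow> norm z"
    using tendsto_norm[OF z] by (simp add: norm_eq u)
  with tendsto_norm[OF fx] have "norm (f x) = norm z"
    by (rule LIMSEQ_unique)
  with xE show ?thesis
    by simp
qed

section \<open>Normal operators and the Fuglede--Putnam theorem\<close>

text \<open>Normality in metric form: operator and adjoint share domain and norms.
  \<open>normal_operator_imp_normal_pair\<close> and \<open>normal_operatorI\<close> connect it with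
  commutation.\<close>

locale normal_pair = adjoint_pair D f D g for D :: "'a::complex_hilbert set" and f g +
  assumes norm_eq: "x \<in> D \<Longrightarrow> norm (f x) = norm (g x)"

context normal_pair
begin

lemma swap_normal: "normal_pair D g f"
  by (intro normal_pair.intro swap normal_pair_axioms.intro) (simp add: norm_eq)

text \<open>Polarization of \<open>norm_eq\<close>; replacing \<open>y\<close> by \<open>i y\<close>
  recovers the imaginary part.\<close>

lemma inner_eq:
  assumes "x \<in> D" "y \<in> D"
  shows "cinner (f x) (f y) = cinner (g x) (g y)"
proof -
  interpret swap: normal_pair D g f
    by (rule swap_normal)
  have Re_eq: "Re (cinner (f u) (f v)) = Re (cinner (g u) (g v))" if "u \<in> D" "v \<in> D" for u v
    using norm_eq[of "u + v"] norm_eq[of u] norm_eq[of v] that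
      norm_add_square[of "f u" "f v"] norm_add_square[of "g u" "g v"]
    by (simp add: linear swap.linear)
  have "Re (cinner (f x) (f (\<i> *\<^sub>C y))) = Re (cinner (g x) (g (\<i> *\<^sub>C y)))"
    using assms by (intro Re_eq) (simp_all add: linear)
  then have "Im (cinner (f x) (f y)) = Im (cinner (g x) (g y))"
    using assms by (simp add: linear swap.linear cinner_scaleC_right)
  with Re_eq[OF assms] show ?thesis
    by (simp add: complex_eq_iff)
qed

text \<open>By \<open>inner_eq\<close>, \<open>g (f x)\<close> is the vector that
  \<open>max_left\<close> asks for at \<open>g x\<close>; this yields commutation together with the
  domain.\<close>

lemma commute:
  assumes "x \<in> D" "f x \<in> D"
  shows "g x \<in> D \<and> f (g x) = g (f x)"
proof (rule max_left)
  fix y assume "y \<in> D"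
  then have "cinner (g y) (g x) = cinner (f y) (f x)"
    using inner_eq assms by simp
  also have "\<dots> = cinner y (g (f x))"
    using adj \<open>y \<in> D\<close> assms by simp
  finally show "cinner (g y) (g x) = cinner y (g (f x))" .
qed

lemma resolvent_swap: "resolvent D g D f = resolvent D f D g"
proof
  interpret swap: normal_pair D g f
    by (rule swap_normal)
  fix u
  define x where "x = resolvent D f D g u"
  have "x \<in> D" "f x \<in> D" "x + g (f x) = u"
    by (simp_all add: x_def resolvent_mem resolvent_eq)
  then show "resolvent D g D f u = resolvent D f D g u"
    unfolding x_def[symmetric] using commute[of x] by (intro swap.resolvent_eqI) auto
qed

lemma resolvent_commute_self: "x \<in> D \<Longrightarrow> f (resolvent D f D g x) = resolvent D f D g (f x)"
  using resolvent_commute by (simp add: resolvent_swap)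

lemma norm_one_plus_square:
  assumes "u \<in> D" "f u \<in> D"
  shows "(norm (u + g (f u)))\<^sup>2 = (norm u)\<^sup>2 + 2 * (norm (f u))\<^sup>2 + (norm (f (f u)))\<^sup>2"
  using assms by (simp add: norm_add_square inner_adj_self Re_cinner_self norm_eq)

lemma affine:
  assumes a: "a \<noteq> 0"
  shows "normal_pair D (\<lambda>x. a *\<^sub>C f x + b *\<^sub>C x) (\<lambda>x. cnj a *\<^sub>C g x + cnj b *\<^sub>C x)"
proof -
  \<comment> \<open>Stated for arbitrary maps and coefficients, to serve \<open>max_right\<close>
    and, with conjugated coefficients and the two maps exchanged, \<open>max_left\<close>.\<close>
  have max: "(\<And>x. x \<in> D \<Longrightarrow> cinner (a *\<^sub>C f x + b *\<^sub>C x) y = cinner x z)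
      \<Longrightarrow> y \<in> D \<and> cnj a *\<^sub>C g y + cnj b *\<^sub>C y = z"
    if max: "\<And>y z. (\<And>x. x \<in> D \<Longrightarrow> cinner (f x) y = cinner x z) \<Longrightarrow> y \<in> D \<and> g y = z"
      and a: "a \<noteq> 0"
    for a b y z f g
  proof -
    assume eq: "\<And>x. x \<in> D \<Longrightarrow> cinner (a *\<^sub>C f x + b *\<^sub>C x) y = cinner x z"
    have "cinner (f x) y = cinner x (inverse (cnj a) *\<^sub>C (z - cnj b *\<^sub>C y))" if "x \<in> D" for x
      using eq[OF that] a by (simp add: cinner_simps field_simps)
    then have "y \<in> D \<and> g y = inverse (cnj a) *\<^sub>C (z - cnj b *\<^sub>C y)"
      by (rule max)
    then show ?thesis
      using a by simp
  qed
  show ?thesis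
  proof
    show "cinner (a *\<^sub>C f x + b *\<^sub>C x) y = cinner x (cnj a *\<^sub>C g y + cnj b *\<^sub>C y)"
      if "x \<in> D" "y \<in> D" for x y
      using adj[OF that] by (simp add: cinner_simps)
    show "y \<in> D \<and> cnj a *\<^sub>C g y + cnj b *\<^sub>C y = z"
      if "\<And>x. x \<in> D \<Longrightarrow> cinner (a *\<^sub>C f x + b *\<^sub>C x) y = cinner x z" for y z
      by (rule max[OF max_right a that])
    show "x \<in> D \<and> a *\<^sub>C f x + b *\<^sub>C x = z"
      if "\<And>y. y \<in> D \<Longrightarrow> cinner (cnj a *\<^sub>C g y + cnj b *\<^sub>C y) x = cinner y z" for x z
    proof -
      have "x \<in> D \<and> cnj (cnj a) *\<^sub>C f x + cnj (cnj b) *\<^sub>C x = z"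
        by (rule max[OF max_left _ that]) (use assms in simp_all)
      then show ?thesis
        by simp
    qed
    show "norm (a *\<^sub>C f x + b *\<^sub>C x) = norm (cnj a *\<^sub>C g x + cnj b *\<^sub>C x)" if "x \<in> D" for x
    proof -
      have "Re (a * cnj b * cinner (f x) x) = Re (cnj a * b * cinner (g x) x)"
        using adj[OF that that] cinner_commute[of x "g x"] by (simp add: algebra_simps)
      then have "(norm (a *\<^sub>C f x + b *\<^sub>C x))\<^sup>2 = (norm (cnj a *\<^sub>C g x + cnj b *\<^sub>C x))\<^sup>2"
        unfolding norm_add_square by (simp add: norm_scaleC norm_eq that cinner_simps mult_ac)
      then show ?thesis
        by (simp add: power2_eq_iff_nonneg)
    qed
  qed
qed

end

section \<open>The Fuglede--Putnam theorem in resolvent form\<close>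

definition intertwines ::
  "real \<Rightarrow> 'a::complex_hilbert set \<Rightarrow> ('a \<Rightarrow> 'a) \<Rightarrow> 'a set \<Rightarrow> ('a \<Rightarrow> 'a) \<Rightarrow> ('a \<Rightarrow> 'a) \<Rightarrow> bool" where
  "intertwines b D f E h F \<longleftrightarrow>
     (\<forall>x. norm (F x) \<le> b * norm x) \<and> (\<forall>x\<in>D. F x \<in> E \<and> h (F x) = F (f x))"

text \<open>Normality enters through \<open>norm_one_plus_square\<close>: it expresses the norm of \<open>(1 + f\<^sup>* f) u\<close> by
  powers of \<open>f\<close> alone, and these are intertwined by \<open>F\<close>. Hence
  \<open>J = (1 + h\<^sup>* h) F (1 + f\<^sup>* f)\<^sup>-\<^sup>1\<close> satisfies the same bound as \<open>F\<close>.\<close>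

lemma intertwines_lift:
  assumes N: "normal_pair D f g" and M: "normal_pair E h k"
    and F: "intertwines b D f E h F" and b: "0 \<le> b"
  obtains J where "intertwines b D f E h J"
    "\<And>x. F (resolvent D f D g x) = resolvent E h E k (J x)"
proof -
  interpret N: normal_pair D f g by (rule N)
  interpret M: normal_pair E h k by (rule M)
  let ?R = "resolvent D f D g"
  define J where "J x = F (?R x) + k (h (F (?R x)))" for x
  have bF: "norm (F x) \<le> b * norm x" and FE: "x \<in> D \<Longrightarrow> F x \<in> E"
    and hF: "x \<in> D \<Longrightarrow> h (F x) = F (f x)" for x
    using F by (simp_all add: intertwines_def)
  have R: "?R x \<in> D" "f (?R x) \<in> D" "?R x + g (f (?R x)) = x" for x
    by (simp_all add: N.resolvent_mem N.resolvent_eq)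
  have Q: "F (?R x) \<in> E" "h (F (?R x)) \<in> E" for x
    by (simp_all add: FE hF R)
  have bF2: "(norm (F x))\<^sup>2 \<le> b\<^sup>2 * (norm x)\<^sup>2" for x
    using power_mono[OF bF norm_ge_zero, of x 2] by (simp add: power_mult_distrib)
  have "norm (J x) \<le> b * norm x" for x
  proof (rule power2_le_imp_le)
    have "(norm (J x))\<^sup>2 = (norm (F (?R x)))\<^sup>2 + 2 * (norm (F (f (?R x))))\<^sup>2
        + (norm (F (f (f (?R x)))))\<^sup>2"
      unfolding J_def by (subst M.norm_one_plus_square) (simp_all add: FE hF R)
    also have "\<dots> \<le> b\<^sup>2 * (norm (?R x))\<^sup>2 + 2 * (b\<^sup>2 * (norm (f (?R x)))\<^sup>2)
        + b\<^sup>2 * (norm (f (f (?R x))))\<^sup>2"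
      by (intro add_mono mult_left_mono bF2) simp_all
    also have "\<dots> = b\<^sup>2 * (norm (?R x + g (f (?R x))))\<^sup>2"
      by (subst N.norm_one_plus_square) (simp_all add: R algebra_simps)
    finally show "(norm (J x))\<^sup>2 \<le> (b * norm x)\<^sup>2"
      by (simp add: R power_mult_distrib)
  qed (use b in simp)
  \<comment> \<open>\<open>J\<close> intertwines again, so the lift can be iterated: the resolvent
    commutes with \<open>f\<close>, and \<open>k\<close> with \<open>h\<close>.\<close>
  moreover have "J x \<in> E \<and> h (J x) = J (f x)" if x: "x \<in> D" for x
  proof -
    define v where "v = F (f (?R x))"
    have Rf: "?R (f x) = f (?R x)"
      by (simp add: N.resolvent_commute_self x)
    have ffR: "f (f (?R x)) \<in> D"
      using R(2)[of "f x"] by (simp add: Rf)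
    have v: "v \<in> E" "h v \<in> E"
      by (simp_all add: v_def FE hF R ffR)
    then have kv: "k v \<in> E" "h (k v) = k (h v)"
      using M.commute by simp_all
    have "J x = F (?R x) + k v" "J (f x) = v + k (h v)"
      by (simp_all add: J_def Rf v_def hF R)
    then show ?thesis
      using kv Q(1)[of x] by (simp add: M.linear) (simp add: v_def hF R)
  qed
  ultimately have "intertwines b D f E h J"
    by (simp add: intertwines_def)
  moreover have "F (?R x) = resolvent E h E k (J x)" for x
    by (rule sym, rule M.resolvent_eqI) (simp_all add: Q J_def)
  ultimately show ?thesis
    using that by blast
qed

text \<open>Iterating the lift preserves \<open>b\<close>, which is why \<open>intertwines\<close>
  carries the bound: \<open>commute_of_power_bound\<close> asks for uniformity in
  \<open>m\<close>.\<close>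

lemma intertwines_lift_power:
  assumes N: "normal_pair D f g" and M: "normal_pair E h k"
    and F: "intertwines b D f E h F" and b: "0 \<le> b"
  shows "\<exists>J. intertwines b D f E h J \<and>
    (\<forall>x. F ((resolvent D f D g ^^ m) x) = (resolvent E h E k ^^ m) (J x))"
proof (induction m)
  case 0
  then show ?case
    using F by auto
next
  case (Suc m)
  then obtain J where J: "intertwines b D f E h J"
    "\<And>x. F ((resolvent D f D g ^^ m) x) = (resolvent E h E k ^^ m) (J x)"
    by blast
  obtain K where K: "intertwines b D f E h K"
    "\<And>x. J (resolvent D f D g x) = resolvent E h E k (K x)"
    using intertwines_lift[OF N M J(1) b] by metis
  have "F ((resolvent D f D g ^^ Suc m) x) = (resolvent E h E k ^^ Suc m) (K x)" for x
    by (simp add: funpow_Suc_right J K del: funpow.simps)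
  with K(1) show ?case
    by blast
qed

text \<open>Off-diagonal trick: \<open>V\<close> is symmetric on the product space even if
  \<open>B\<close> is not. That it commutes with the diagonal \<open>W\<close> is, at
  \<open>(0, x)\<close>, the claim.\<close>

lemma intertwines_resolvent:
  assumes N: "normal_pair D f g" and M: "normal_pair E h k"
    and B: "is_adjoint B Bs" and intB: "intertwines b D f E h B"
    and bBs: "\<And>x. norm (Bs x) \<le> b * norm x" and b: "0 \<le> b"
  shows "B (resolvent D f D g x) = resolvent E h E k (B x)"
proof -
  interpret N: normal_pair D f g by (rule N)
  interpret M: normal_pair E h k by (rule M)
  note Bs = is_adjoint_swap[OF B]
  let ?R = "resolvent D f D g" and ?Q = "resolvent E h E k"
  note R = N.resolvent_self_adjoint and Q = M.resolvent_self_adjoint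
  have bB: "norm (B x) \<le> b * norm x" for x
    using intB by (simp add: intertwines_def)
  \<comment> \<open>Taking adjoints reverses the direction: \<open>Bs\<close> intertwines
    \<open>k\<close> and \<open>g\<close>. By normality their resolvents are again \<open>?Q\<close>
    and \<open>?R\<close>.\<close>
  have "intertwines b E k D g Bs"
    unfolding intertwines_def
  proof (intro conjI allI ballI bBs)
    fix y assume "y \<in> E"
    then have "cinner (f x) (Bs y) = cinner x (Bs (k y))" if "x \<in> D" for x
      using M.adj[of "B x" y] intB that by (simp add: intertwines_def flip: is_adjointD[OF B])
    then have "Bs y \<in> D \<and> g (Bs y) = Bs (k y)"
      by (rule N.max_right)
    then show "Bs y \<in> D" "g (Bs y) = Bs (k y)"
      by simp_all
  qed
  then have liftBs: "\<exists>J. (\<forall>x. norm (J x) \<le> b * norm x) \<and> (\<forall>x. Bs ((?Q ^^ m) x) = (?R ^^ m) (J x))" for m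
    using intertwines_lift_power[OF M.swap_normal N.swap_normal _ b, of Bs m]
    by (auto simp: intertwines_def M.resolvent_swap N.resolvent_swap)
  have liftB: "\<exists>J. (\<forall>x. norm (J x) \<le> b * norm x) \<and> (\<forall>x. B ((?R ^^ m) x) = (?Q ^^ m) (J x))" for m
    using intertwines_lift_power[OF N M intB b, of m] by (auto simp: intertwines_def)
  \<comment> \<open>The lift of \<open>G\<close> bounds \<open>Q^m F\<close>: moving the factors
    across the inner product gives \<open>|y|^2 = cinner (P^m x) (J y)\<close>.\<close>
  have dual: "norm ((Q ^^ m) (F x)) \<le> b * norm ((P ^^ m) x)"
    if F: "is_adjoint F G" and Q: "is_adjoint Q Q" and P: "is_adjoint P P"
      and lift: "\<exists>J. (\<forall>x. norm (J x) \<le> b * norm x) \<and> (\<forall>x. G ((Q ^^ m) x) = (P ^^ m) (J x))"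
    for F G Q P :: "'a \<Rightarrow> 'a" and m x
  proof -
    obtain J where J: "\<And>x. norm (J x) \<le> b * norm x" "\<And>x. G ((Q ^^ m) x) = (P ^^ m) (J x)"
      using lift by blast
    define y where "y = (Q ^^ m) (F x)"
    have "cinner y y = cinner ((P ^^ m) x) (J y)"
      unfolding y_def is_adjointD[OF is_adjoint_funpow[OF Q], of m "F x"]
      unfolding is_adjointD[OF F] J(2) is_adjointD[OF is_adjoint_funpow[OF P]] ..
    then have "norm y * norm y \<le> norm ((P ^^ m) x) * norm (J y)"
      using cauchy_schwarz[of "(P ^^ m) x" "J y"]
      by (metis cinner_self_norm norm_of_real abs_power2 real_norm_def power2_eq_square norm_power)
    also have "\<dots> \<le> norm ((P ^^ m) x) * (b * norm y)"
      by (intro mult_left_mono J) simp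
    finally have "norm y * norm y \<le> (b * norm ((P ^^ m) x)) * norm y"
      by (simp add: mult_ac)
    then show ?thesis
      using b by (cases "norm y = 0") (auto simp: y_def)
  qed
  define W where "W p = (?Q (fst p), ?R (snd p))" for p
  define V where "V p = (B (snd p), Bs (fst p))" for p
  have Wm: "(W ^^ m) p = ((?Q ^^ m) (fst p), (?R ^^ m) (snd p))" for m p
    by (induction m) (simp_all add: W_def)
  have norm_le: "norm (p', q') \<le> b * norm (p, q)"
    if "norm p' \<le> b * norm q" "norm q' \<le> b * norm p" for p q p' q' :: 'a
  proof -
    have "norm (p', q') \<le> sqrt ((b * norm q)\<^sup>2 + (b * norm p)\<^sup>2)"
      unfolding norm_Pair using that by (intro real_sqrt_le_mono add_mono power_mono) auto
    also have "\<dots> = sqrt (b\<^sup>2 * ((norm p)\<^sup>2 + (norm q)\<^sup>2))"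
      by (simp add: power_mult_distrib algebra_simps)
    also have "\<dots> = b * norm (p, q)"
      using b by (simp add: norm_Pair real_sqrt_mult)
    finally show ?thesis .
  qed
  have "W (V (0, x)) = V (W (0, x))"
  proof (rule commute_of_power_bound)
    show "is_adjoint W W"
      by (simp add: is_adjoint_def W_def cinner_prod_def is_adjointD[OF R] is_adjointD[OF Q])
    show "0 \<le> Re (cinner (W p) p)" for p
      by (simp add: W_def cinner_prod_def N.resolvent_pos M.resolvent_pos)
    show "is_adjoint V V"
      by (simp add: is_adjoint_def V_def cinner_prod_def is_adjointD[OF B] is_adjointD[OF Bs])
    show "norm (V p) \<le> b * norm p" for p
      using norm_le[OF bB bBs, of "snd p" "fst p"] by (simp add: V_def)
    show "\<exists>q. V ((W ^^ m) p) = (W ^^ m) q" for m p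
    proof -
      obtain J K where "\<And>x. B ((?R ^^ m) x) = (?Q ^^ m) (J x)" "\<And>x. Bs ((?Q ^^ m) x) = (?R ^^ m) (K x)"
        using liftB liftBs by metis
      then have "V ((W ^^ m) p) = (W ^^ m) (J (snd p), K (fst p))"
        by (simp add: V_def Wm)
      then show ?thesis ..
    qed
    show "norm ((W ^^ m) (V p)) \<le> b * norm ((W ^^ m) p)" for m p
      unfolding Wm V_def fst_conv snd_conv
      by (intro norm_le dual[OF B Q R liftBs] dual[OF Bs R Q liftB])
  qed (rule b)
  then show ?thesis
    by (simp add: V_def W_def)
qed

section \<open>Bounded normal \<open>B\<close> with
  \<open>B A \<subseteq> \<lambda> A B\<close>\<close>

locale intertwining = normal_pair D f g for D :: "'a::complex_hilbert set" and f g +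
  fixes B Bs :: "'a \<Rightarrow> 'a" and b :: real and l :: complex
  assumes is_adjoint_B: "is_adjoint B Bs"
    and norm_Bs: "norm (Bs x) = norm (B x)"
    and norm_B_le: "norm (B x) \<le> b * norm x" and b_nonneg: "0 \<le> b"
    and l_nonzero: "l \<noteq> 0"
    and B_mem: "x \<in> D \<Longrightarrow> B x \<in> D"
    and B_f: "x \<in> D \<Longrightarrow> B (f x) = l *\<^sub>C f (B x)"
begin

sublocale swap: normal_pair D g f
  by (rule swap_normal)

lemmas B_adj = is_adjointD[OF is_adjoint_B]
lemmas B_linear = is_adjoint_linear[OF is_adjoint_B]

text \<open>Fuglede--Putnam for \<open>A + c\<close> and \<open>\<lambda> A + c\<close>; the factors
  \<open>1\<close> and \<open>cnj 1\<close> keep the terms instances of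
  \<open>affine\<close>.\<close>

lemma B_resolvent_affine:
  fixes c :: complex
  shows "B (resolvent D (\<lambda>x. 1 *\<^sub>C f x + c *\<^sub>C x) D (\<lambda>x. cnj 1 *\<^sub>C g x + cnj c *\<^sub>C x) x)
       = resolvent D (\<lambda>x. l *\<^sub>C f x + c *\<^sub>C x) D (\<lambda>x. cnj l *\<^sub>C g x + cnj c *\<^sub>C x) (B x)"
proof (rule intertwines_resolvent[OF affine affine is_adjoint_B _ _ b_nonneg])
  show "intertwines b D (\<lambda>x. 1 *\<^sub>C f x + c *\<^sub>C x) D (\<lambda>x. l *\<^sub>C f x + c *\<^sub>C x) B"
    by (simp add: intertwines_def norm_B_le B_mem B_f B_linear scaleC_one)
  show "norm (Bs x) \<le> b * norm x" for x
    by (simp add: norm_Bs norm_B_le)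
qed (simp_all add: l_nonzero)

text \<open>\<open>B_resolvent_affine\<close> with the resolvents cleared: \<open>u\<close> is the
  resolvent of the argument of \<open>B\<close> on the right.\<close>

lemma B_one_plus:
  assumes u: "u \<in> D" "f u \<in> D"
  shows "B u + (cnj l *\<^sub>C g (B (f u) + c *\<^sub>C B u) + cnj c *\<^sub>C (B (f u) + c *\<^sub>C B u))
    = B (u + (g (f u + c *\<^sub>C u) + cnj c *\<^sub>C (f u + c *\<^sub>C u)))"
proof -
  interpret N: normal_pair D "\<lambda>x. 1 *\<^sub>C f x + c *\<^sub>C x" "\<lambda>x. cnj 1 *\<^sub>C g x + cnj c *\<^sub>C x"
    by (rule affine) simp
  interpret M: normal_pair D "\<lambda>x. l *\<^sub>C f x + c *\<^sub>C x" "\<lambda>x. cnj l *\<^sub>C g x + cnj c *\<^sub>C x"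
    by (rule affine) (rule l_nonzero)
  define y where "y = u + (g (f u + c *\<^sub>C u) + cnj c *\<^sub>C (f u + c *\<^sub>C u))"
  have "resolvent D (\<lambda>x. 1 *\<^sub>C f x + c *\<^sub>C x) D (\<lambda>x. cnj 1 *\<^sub>C g x + cnj c *\<^sub>C x) y = u"
    by (rule N.resolvent_eqI) (use u in \<open>simp_all add: y_def linear scaleC_one\<close>)
  then have "B u = resolvent D (\<lambda>x. l *\<^sub>C f x + c *\<^sub>C x) D (\<lambda>x. cnj l *\<^sub>C g x + cnj c *\<^sub>C x) (B y)"
    using B_resolvent_affine[of c y] by simp
  then show ?thesis
    using M.resolvent_eq[of "B y"] by (simp add: B_f[OF u(1)] y_def)
qed

text \<open>Fuglede's theorem \<open>B A\<^sup>* \<subseteq> \<lambda>\<^sup>* A\<^sup>* B\<close>. On the domain of \<open>A\<^sup>* A\<close> it is the difference of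
  \<open>B_one_plus\<close> for \<open>A\<close> and for \<open>A + 1\<close>; in general, apply the injective resolvent to both sides.\<close>

lemma B_g:
  assumes x: "x \<in> D"
  shows "B (g x) = cnj l *\<^sub>C g (B x)"
proof -
  have core: "B (g u) = cnj l *\<^sub>C g (B u)" if u: "u \<in> D" "f u \<in> D" for u
  proof -
    have mem: "B u \<in> D" "B (f u) \<in> D"
      using u B_mem by simp_all
    have "cnj l *\<^sub>C g (B (f u)) = B (g (f u))"
      using B_one_plus[OF u, of 0] by (simp add: B_linear)
    then show ?thesis
      using B_one_plus[OF u, of 1] mem u
      by (simp add: B_linear swap.linear scaleC_one scaleC_add_right algebra_simps)
  qed
  interpret M: normal_pair D "\<lambda>x. cnj l *\<^sub>C g x + cnj 0 *\<^sub>C x" "\<lambda>x. l *\<^sub>C f x + 0 *\<^sub>C x"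
    using affine[OF l_nonzero, of 0] by (rule normal_pair.swap_normal)
  let ?R = "resolvent D f D g"
  let ?Q = "resolvent D (\<lambda>x. cnj l *\<^sub>C g x + cnj 0 *\<^sub>C x) D (\<lambda>x. l *\<^sub>C f x + 0 *\<^sub>C x)"
  have BR: "B (?R y) = ?Q (B y)" for y
    using B_resolvent_affine[of 0 y] unfolding M.resolvent_swap by (simp add: scaleC_one)
  have "?Q (B (g x)) = B (g (?R x))"
    using swap.resolvent_commute_self[OF x] by (simp add: BR resolvent_swap)
  also have "\<dots> = cnj l *\<^sub>C g (B (?R x))"
    by (rule core) (simp_all add: resolvent_mem)
  also have "\<dots> = ?Q (cnj l *\<^sub>C g (B x))"
    using M.resolvent_commute_self[OF B_mem[OF x]] by (simp add: BR)
  finally have "?Q (B (g x) - cnj l *\<^sub>C g (B x)) = 0"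
    unfolding is_adjoint_diff[OF M.resolvent_self_adjoint] by simp
  then show ?thesis
    unfolding M.resolvent_eq_0_iff by simp
qed

lemma Bs_mem_and_g:
  assumes x: "x \<in> D"
  shows "Bs x \<in> D \<and> g (Bs x) = cnj l *\<^sub>C Bs (g x)"
proof (rule max_right)
  fix y assume y: "y \<in> D"
  then show "cinner (f y) (Bs x) = cinner y (cnj l *\<^sub>C Bs (g x))"
    using adj[OF B_mem[OF y] x] by (simp add: cinner_simps B_f flip: B_adj)
qed

lemma norm_Bs_g:
  assumes "x \<in> D"
  shows "norm (Bs (g x)) = cmod l * norm (f (B x))"
  using assms by (simp add: norm_Bs B_g norm_scaleC norm_eq B_mem)

text \<open>The nonvanishing hypothesis concerns the whole domain of \<open>A B\<close>, the norm
  identity only \<open>D\<close>. If \<open>f B\<close> vanishes on \<open>D\<close>, so does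
  \<open>Bs g\<close>, and by duality \<open>f B\<close> vanishes wherever it is defined.\<close>

lemma product_eq_0:
  assumes zero: "\<And>x. x \<in> D \<Longrightarrow> f (B x) = 0" and x: "B x \<in> D"
  shows "f (B x) = 0"
proof (rule orthogonal_to_domain)
  fix y assume y: "y \<in> D"
  then have "Bs (g y) = 0"
    using norm_Bs_g[OF y] by (simp add: zero)
  then have "cinner (f (B x)) y = 0"
    using adj[OF x y] by (simp add: B_adj)
  then show "cinner y (f (B x)) = 0"
    using cinner_commute[of y "f (B x)"] by simp
qed

text \<open>For unimodular \<open>l\<close> the operators \<open>A\<close> and \<open>l A\<close>
  have the same resolvent, since \<open>cnj l * l = 1\<close>.\<close>

lemma B_resolvent:
  assumes "cmod l = 1"
  shows "B (resolvent D f D g x) = resolvent D f D g (B x)"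
proof -
  interpret M: normal_pair D "\<lambda>x. l *\<^sub>C f x + 0 *\<^sub>C x" "\<lambda>x. cnj l *\<^sub>C g x + cnj 0 *\<^sub>C x"
    by (rule affine) (rule l_nonzero)
  have "cnj l * l = 1"
    using assms complex_norm_square[of l] by (simp add: mult.commute)
  then have "resolvent D (\<lambda>x. l *\<^sub>C f x + 0 *\<^sub>C x) D (\<lambda>x. cnj l *\<^sub>C g x + cnj 0 *\<^sub>C x) y
      = resolvent D f D g y" for y
    by (intro M.resolvent_eqI)
      (simp_all add: linear swap.linear resolvent_mem resolvent_eq scaleC_scaleC scaleC_one)
  then show ?thesis
    using B_resolvent_affine[of 0 x] by (simp add: scaleC_one)
qed

text \<open>Inverting \<open>g Bs = cnj l Bs g\<close> gives back the factor \<open>l\<close>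
  exactly when \<open>|l| = 1\<close>; then every result on \<open>A B\<close> also holds for the
  adjoints.\<close>

lemma intertwining_adjoint:
  assumes l: "cmod l = 1"
  shows "intertwining D g f Bs B b l"
proof
  have ll: "l * cnj l = 1"
    using l complex_norm_square[of l] by simp
  show "is_adjoint Bs B"
    by (rule is_adjoint_swap[OF is_adjoint_B])
  show "norm (B x) = norm (Bs x)" for x
    by (simp add: norm_Bs)
  show "norm (Bs x) \<le> b * norm x" for x
    by (simp add: norm_Bs norm_B_le)
  show "Bs x \<in> D" if "x \<in> D" for x
    using Bs_mem_and_g[OF that] by simp
  show "Bs (g x) = l *\<^sub>C g (Bs x)" if "x \<in> D" for x
    using Bs_mem_and_g[OF that] by (simp add: scaleC_scaleC ll scaleC_one)
qed (simp_all add: b_nonneg l_nonzero)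

lemma bounded_linear_B: "bounded_linear B"
proof (rule bounded_linear_intro)
  show "norm (B x) \<le> norm x * b" for x
    using norm_B_le[of x] by (simp add: mult.commute)
qed (simp_all add: B_linear scaleR_scaleC)

lemma graph_product:
  assumes "csubspace (graph_on D h)" and "closed (graph_on D h)"
  shows "csubspace (graph_on {x. B x \<in> D} (\<lambda>x. h (B x)))"
    and "closed (graph_on {x. B x \<in> D} (\<lambda>x. h (B x)))"
proof -
  note lin = graph_on_linear[OF assms(1)]
  have "B 0 = 0"
    using B_linear(2)[of 0 0] by simp
  then show "csubspace (graph_on {x. B x \<in> D} (\<lambda>x. h (B x)))"
    by (intro graph_on_csubspaceI) (simp_all add: lin B_linear)
  have "graph_on {x. B x \<in> D} (\<lambda>x. h (B x)) = (\<lambda>p. (B (fst p), snd p)) -` graph_on D h"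
    by (auto simp: graph_on_def image_iff)
  moreover have "continuous_on UNIV (\<lambda>p. (B (fst p), snd p))"
    by (intro continuous_on_Pair continuous_on_snd bounded_linear.continuous_on[OF bounded_linear_B]
        continuous_on_fst continuous_on_id)
  ultimately show "closed (graph_on {x. B x \<in> D} (\<lambda>x. h (B x)))"
    using assms(2) closed_vimage by metis
qed

end

text \<open>For \<open>|\<lambda>| = 1\<close> the resolvent of \<open>A\<^sup>* A\<close> commutes with \<open>A B\<close>, so that the domain of \<open>A\<close> is a
  core for \<open>A B\<close>; the adjoint of \<open>A B\<close> turns out to be \<open>\<lambda> A\<^sup>* B\<^sup>*\<close>.\<close>

locale unimodular_intertwining = intertwining +
  assumes cmod_l: "cmod l = 1"
begin

sublocale star: intertwining D g f Bs B b l
  by (rule intertwining_adjoint[OF cmod_l])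

abbreviation R where "R \<equiv> resolvent D f D g"

lemma csubspace_D: "csubspace D"
  by (simp add: csubspace_def linear)

lemma product_resolvent: "B w \<in> D \<Longrightarrow> f (B (R w)) = R (f (B w))"
  by (simp add: B_resolvent cmod_l resolvent_commute_self)

lemma star_product_resolvent: "Bs w \<in> D \<Longrightarrow> g (Bs (R w)) = R (g (Bs w))"
  using star.B_resolvent[OF cmod_l, of w] swap.resolvent_commute_self[of "Bs w"]
  by (simp add: resolvent_swap)

lemma norm_product_on_D: "u \<in> D \<Longrightarrow> norm (f (B u)) = norm (g (Bs u))"
  using norm_Bs_g[of u] by (simp add: star.B_f norm_scaleC cmod_l)

lemma product_domain:
  "B x \<in> D \<Longrightarrow> Bs x \<in> D \<and> norm (f (B x)) = norm (g (Bs x))"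
  using core_transfer[OF graph_product[OF csubspace_graph closed_graph]
      star.graph_product[OF swap.csubspace_graph swap.closed_graph] csubspace_D, of R x]
  by (simp add: B_mem star.B_mem norm_product_on_D product_resolvent resolvent_mem
      resolvent_pos resolvent_strict_pos subset_iff)

lemma star_product_domain:
  "Bs x \<in> D \<Longrightarrow> B x \<in> D"
  using core_transfer[OF star.graph_product[OF swap.csubspace_graph swap.closed_graph]
      graph_product[OF csubspace_graph closed_graph] csubspace_D, of R x]
  by (simp add: B_mem star.B_mem norm_product_on_D star_product_resolvent resolvent_mem
      resolvent_pos resolvent_strict_pos subset_iff)

lemma product_normal: "normal_pair {x. B x \<in> D} (\<lambda>x. f (B x)) (\<lambda>x. l *\<^sub>C g (Bs x))"
proof -
  let ?D = "{x. B x \<in> D}" and ?C = "\<lambda>x. f (B x)" and ?Cs = "\<lambda>x. l *\<^sub>C g (Bs x)"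
  \<comment> \<open>\<open>E\<close> will be the domain of the adjoint of \<open>A B\<close>; a
    priori it may be smaller than that of \<open>A\<^sup>* B\<^sup>*\<close>.\<close>
  define E where "E = {y. Bs y \<in> D \<and> (\<forall>x\<in>?D. cinner (?C x) y = cinner x (?Cs y))}"
  have ll: "l * cnj l = 1" "cnj l * l = 1"
    using cmod_l complex_norm_square[of l] by (simp_all add: mult.commute)
  have pair: "adjoint_pair ?D ?C E ?Cs"
  proof (rule adjoint_pair_of_closed[OF graph_product[OF csubspace_graph closed_graph]])
    show "cinner (?C x) y = cinner x (?Cs y)" if "x \<in> ?D" "y \<in> E" for x y
      using that by (simp add: E_def)
    show "y \<in> E \<and> ?Cs y = z" if yz: "\<And>x. x \<in> ?D \<Longrightarrow> cinner (?C x) y = cinner x z" for y z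
    proof -
      \<comment> \<open>Testing on \<open>D\<close>, where \<open>B f = l f B\<close>, already
        forces \<open>Bs y\<close> into \<open>D\<close>.\<close>
      have "cinner (f x) (Bs y) = cinner x (cnj l *\<^sub>C z)" if x: "x \<in> D" for x
        using yz[of x] B_mem[OF x] x by (simp add: B_f cinner_simps flip: B_adj)
      then have "Bs y \<in> D \<and> g (Bs y) = cnj l *\<^sub>C z"
        by (rule max_right)
      then show ?thesis
        using yz by (simp add: E_def scaleC_scaleC ll scaleC_one)
    qed
  qed
  then interpret C: adjoint_pair ?D ?C E ?Cs .
  interpret C': adjoint_pair E ?Cs ?D ?C
    by (rule C.swap)
  interpret S: normal_pair D "\<lambda>x. l *\<^sub>C g x + 0 *\<^sub>C x" "\<lambda>x. cnj l *\<^sub>C f x + cnj 0 *\<^sub>C x"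
    by (rule swap.affine) (rule l_nonzero)
  have DE: "u \<in> E" if u: "u \<in> D" for u
  proof -
    have "cinner (?C x) u = cinner x (?Cs u)" if "B x \<in> D" for x
      using adj[OF that u] u by (simp add: B_adj star.B_f)
    then show ?thesis
      using star.B_mem[OF u] by (simp add: E_def)
  qed
  \<comment> \<open>\<open>D\<close> is a core for \<open>l A\<^sup>* B\<^sup>*\<close>, which
    agrees there with the closed adjoint of \<open>A B\<close>; hence \<open>E\<close> is the full
    domain.\<close>
  have "x \<in> E" if "Bs x \<in> D" for x
    using core_transfer[OF star.graph_product[OF S.csubspace_graph S.closed_graph]
        C'.csubspace_graph C'.closed_graph csubspace_D, of R x] that
    by (simp add: star.B_mem DE star_product_resolvent resolvent_mem resolvent_pos
        resolvent_strict_pos subset_iff is_adjoint_scaleC[OF resolvent_self_adjoint])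
  then have "E = ?D"
    using product_domain star_product_domain by (auto simp: E_def)
  with pair have "adjoint_pair ?D ?C ?D ?Cs"
    by simp
  then show ?thesis
    by (intro normal_pair.intro normal_pair_axioms.intro)
      (simp_all add: product_domain norm_scaleC cmod_l)
qed

end

section \<open>Operators as partial functions\<close>

lemma csubspace_graph_operator:
  assumes "linear_operator T"
  shows "csubspace (graph_on (dom T) (\<lambda>x. the (T x)))"
proof (rule graph_on_csubspaceI)
  show "0 \<in> dom T"
    using assms by (simp add: linear_operator_def)
  show "x + y \<in> dom T \<and> the (T (x + y)) = the (T x) + the (T y)"
    if "x \<in> dom T" "y \<in> dom T" for x y
  proof -
    have "T (x + y) = Some (the (T x) + the (T y))"
      using assms that by (simp add: linear_operator_def)
    then show ?thesis
      by auto
  qed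
  show "c *\<^sub>C x \<in> dom T \<and> the (T (c *\<^sub>C x)) = c *\<^sub>C the (T x)" if "x \<in> dom T" for c x
  proof -
    have "T (c *\<^sub>C x) = Some (c *\<^sub>C the (T x))"
      using assms that by (simp add: linear_operator_def)
    then show ?thesis
      by auto
  qed
qed

lemma graph_eq_graph_on: "Map.graph T = graph_on (dom T) (\<lambda>x. the (T x))"
  by (auto simp: Map.graph_def graph_on_def image_iff)

lemma adjoint_operator_someD:
  assumes "y \<in> dom (adjoint_operator T)" and "x \<in> dom T"
  shows "cinner (the (T x)) y = cinner x (the (adjoint_operator T y))"
proof -
  have ex: "\<exists>z. \<forall>x\<in>dom T. cinner (the (T x)) y = cinner x z"
    using assms(1) by (auto simp: adjoint_operator_def dom_def split: if_splits)
  from someI_ex[OF ex] ex assms(2) show ?thesis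
    by (simp add: adjoint_operator_def)
qed

lemma adjoint_operator_eqI:
  assumes dense: "\<And>z. (\<And>x. x \<in> dom T \<Longrightarrow> cinner x z = 0) \<Longrightarrow> z = 0"
    and yz: "\<And>x. x \<in> dom T \<Longrightarrow> cinner (the (T x)) y = cinner x z"
  shows "adjoint_operator T y = Some z"
proof -
  have ex: "\<exists>z. \<forall>x\<in>dom T. cinner (the (T x)) y = cinner x z"
    using yz by blast
  then have y: "y \<in> dom (adjoint_operator T)"
    by (auto simp: adjoint_operator_def)
  have "the (adjoint_operator T y) - z = 0"
    using yz adjoint_operator_someD[OF y] by (intro dense) (simp add: cinner_diff_right)
  with y show ?thesis
    by auto
qed

lemma adjoint_pair_operator:
  assumes "linear_operator T" "densely_defined T" "closed_operator T"
  shows "adjoint_pair (dom T) (\<lambda>x. the (T x)) (dom (adjoint_operator T)) (\<lambda>x. the (adjoint_operator T x))"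
proof (rule adjoint_pair_of_closed)
  show "csubspace (graph_on (dom T) (\<lambda>x. the (T x)))"
    by (rule csubspace_graph_operator[OF assms(1)])
  show "closed (graph_on (dom T) (\<lambda>x. the (T x)))"
    using assms(3) by (simp add: closed_operator_def graph_eq_graph_on)
  show "cinner (the (T x)) y = cinner x (the (adjoint_operator T y))"
    if "x \<in> dom T" "y \<in> dom (adjoint_operator T)" for x y
    using adjoint_operator_someD that by blast
  have dense: "z = 0" if "\<And>x. x \<in> dom T \<Longrightarrow> cinner x z = 0" for z
    using assms(2) that unfolding densely_defined_def by (rule orthogonal_to_dense)
  show "y \<in> dom (adjoint_operator T) \<and> the (adjoint_operator T y) = z"
    if "\<And>x. x \<in> dom T \<Longrightarrow> cinner (the (T x)) y = cinner x z" for y z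
    using adjoint_operator_eqI[OF dense that] by auto
qed

lemma map_comp_eq_Some: "(S \<circ>\<^sub>m T) x = Some z \<longleftrightarrow> x \<in> dom T \<and> the (T x) \<in> dom S \<and> the (S (the (T x))) = z"
  by (auto simp: map_comp_def dom_def split: option.splits)

text \<open>Commutation gives equal norms on the domain of \<open>T\<^sup>* T\<close>. The resolvent
  maps into this domain, so \<open>core_transfer\<close> extends the equality to \<open>T\<close>
  and to its adjoint.\<close>

lemma normal_operator_imp_normal_pair:
  assumes "normal_operator T"
  shows "normal_pair (dom T) (\<lambda>x. the (T x)) (\<lambda>x. the (adjoint_operator T x))"
    and "dom (adjoint_operator T) = dom T"
proof -
  let ?S = "adjoint_operator T"
  let ?f = "\<lambda>x. the (T x)" and ?g = "\<lambda>x. the (?S x)"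
  interpret P: adjoint_pair "dom T" ?f "dom ?S" ?g
    using assms adjoint_pair_operator unfolding normal_operator_def by blast
  interpret Q: adjoint_pair "dom ?S" ?g "dom T" ?f
    by (rule P.swap)
  have "(T \<circ>\<^sub>m ?S) x = Some z \<longleftrightarrow> (?S \<circ>\<^sub>m T) x = Some z" for x z
    using assms by (simp add: normal_operator_def)
  then have comm: "x \<in> dom ?S \<and> ?g x \<in> dom T \<and> ?f (?g x) = z
      \<longleftrightarrow> x \<in> dom T \<and> ?f x \<in> dom ?S \<and> ?g (?f x) = z" for x z
    unfolding map_comp_eq_Some .
  define R where "R = resolvent (dom T) ?f (dom ?S) ?g"
  have R: "R x \<in> dom T" "?f (R x) \<in> dom ?S" "R x + ?g (?f (R x)) = x" for x
    by (simp_all only: R_def P.resolvent_mem P.resolvent_eq)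
  \<comment> \<open>As the two products agree, \<open>R x\<close> also solves the resolvent equation
    of \<open>T T\<^sup>*\<close>.\<close>
  have R': "R x \<in> dom ?S" "?g (R x) \<in> dom T" "R x + ?f (?g (R x)) = x" for x
    using comm[of "R x" "?g (?f (R x))"] R[of x] by simp_all
  have R_eq: "resolvent (dom ?S) ?g (dom T) ?f = R"
    by (rule ext, rule Q.resolvent_eqI) (rule R')+
  define D0 where "D0 = {x \<in> dom T. ?f x \<in> dom ?S}"
  have D0: "csubspace D0" "D0 \<subseteq> dom T" "D0 \<subseteq> dom ?S"
    using comm by (auto simp: D0_def csubspace_def P.linear Q.linear)
  have norm_D0: "norm (?f u) = norm (?g u)" if "u \<in> D0" for u
  proof -
    have u: "u \<in> dom T" "?f u \<in> dom ?S" "u \<in> dom ?S" "?g u \<in> dom T" "?f (?g u) = ?g (?f u)"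
      using that comm[of u "?g (?f u)"] by (simp_all add: D0_def)
    have "cinner (?f u) (?f u) = cinner (?g u) (?g u)"
      using P.adj[OF u(1,2)] Q.adj[OF u(3,4)] u(5) by simp
    then have "(norm (?f u))\<^sup>2 = (norm (?g u))\<^sup>2"
      by (metis Re_cinner_self)
    then show ?thesis
      by (simp add: power2_eq_iff_nonneg)
  qed
  have RD0: "R w \<in> D0" for w
    using R by (simp add: D0_def)
  have pos: "0 \<le> Re (cinner (R w) w)" "Re (cinner (R w) w) = 0 \<Longrightarrow> w = 0" for w
    unfolding R_def by (rule P.resolvent_pos, erule P.resolvent_strict_pos)
  have 1: "x \<in> dom ?S \<and> norm (?f x) = norm (?g x)" if "x \<in> dom T" for x
  proof (rule core_transfer[OF P.csubspace_graph P.closed_graph Q.csubspace_graph Q.closed_graph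
        D0 norm_D0 RD0 _ pos that])
    show "?f (R w) = R (?f w)" if "w \<in> dom T" for w
      using P.resolvent_commute[OF that] unfolding R_eq unfolding R_def .
  qed
  have 2: "x \<in> dom T \<and> norm (?g x) = norm (?f x)" if "x \<in> dom ?S" for x
  proof (rule core_transfer[OF Q.csubspace_graph Q.closed_graph P.csubspace_graph P.closed_graph
        D0(1,3,2) norm_D0[symmetric] RD0 _ pos that])
    show "?g (R w) = R (?g w)" if "w \<in> dom ?S" for w
      using Q.resolvent_commute[OF that] unfolding R_eq unfolding R_def .
  qed
  show dom_eq: "dom ?S = dom T"
    using 1 2 by blast
  have "adjoint_pair (dom T) ?f (dom T) ?g"
    using P.adjoint_pair_axioms unfolding dom_eq .
  then show "normal_pair (dom T) ?f ?g"
    by (intro normal_pair.intro normal_pair_axioms.intro) (simp_all add: 1)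
qed

text \<open>Density makes the choice in \<open>adjoint_operator\<close> unique, so it agrees with
  \<open>g\<close> on \<open>D\<close>; \<open>commute\<close> in both orders then equates the
  products with their domains.\<close>

lemma normal_operatorI:
  assumes N: "normal_pair D f g" and dom: "dom T = D" and f: "\<And>x. x \<in> D \<Longrightarrow> the (T x) = f x"
    and lin: "linear_operator T" and dense: "densely_defined T"
  shows "normal_operator T"
proof -
  interpret N: normal_pair D f g
    by (rule N)
  interpret N': normal_pair D g f
    by (rule N.swap_normal)
  have "Map.graph T = graph_on D f"
    unfolding graph_eq_graph_on dom using f by (auto simp: graph_on_def)
  then have closed: "closed_operator T"
    by (simp add: closed_operator_def N.closed_graph)
  interpret P: adjoint_pair "dom T" "\<lambda>x. the (T x)"
      "dom (adjoint_operator T)" "\<lambda>x. the (adjoint_operator T x)"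
    by (rule adjoint_pair_operator[OF lin dense closed])
  have adj: "y \<in> dom (adjoint_operator T) \<and> the (adjoint_operator T y) = g y" if "y \<in> D" for y
    by (rule P.max_right) (simp add: dom f N.adj that)
  have "y \<in> D" if y: "y \<in> dom (adjoint_operator T)" for y
  proof -
    have "cinner (f x) y = cinner x (the (adjoint_operator T y))" if "x \<in> D" for x
      using P.adj[of x y] that y by (simp add: dom f)
    then show ?thesis
      using N.max_right by blast
  qed
  with adj have dom_eq: "dom (adjoint_operator T) = D"
    by blast
  have "(T \<circ>\<^sub>m adjoint_operator T) x = Some z \<longleftrightarrow> (adjoint_operator T \<circ>\<^sub>m T) x = Some z" for x z
    unfolding map_comp_eq_Some dom_eq dom
    using N.commute[of x] N'.commute[of x] adj f by metis
  then have "T \<circ>\<^sub>m adjoint_operator T = adjoint_operator T \<circ>\<^sub>m T"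
    by (intro ext) (metis not_Some_eq)
  with lin dense closed show ?thesis
    by (simp add: normal_operator_def)
qed

theorem theorem2p2:
  fixes A B :: "'a::complex_hilbert \<rightharpoonup> 'a" and l :: complex
  assumes "normal_operator A"
    and "bounded_operator B" and "normal_operator B"
    and "B \<circ>\<^sub>m A \<subseteq>\<^sub>m scale_operator l (A \<circ>\<^sub>m B)"
    and "\<exists>x \<in> dom (scale_operator l (A \<circ>\<^sub>m B)). the (scale_operator l (A \<circ>\<^sub>m B) x) \<noteq> 0"
  shows "normal_operator (A \<circ>\<^sub>m B) \<longleftrightarrow> cmod l = 1"
proof -
  define f where "f = (\<lambda>x. the (A x))"
  define g where "g = (\<lambda>x. the (adjoint_operator A x))"
  define b where "b = (\<lambda>x. the (B x))"
  define bs where "bs = (\<lambda>x. the (adjoint_operator B x))"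
  let ?D = "dom A" and ?C = "A \<circ>\<^sub>m B"
  have domB: "dom B = UNIV"
    using assms(2) by (simp add: bounded_operator_def)
  interpret N: normal_pair ?D f g
    unfolding f_def g_def by (rule normal_operator_imp_normal_pair[OF assms(1)])
  interpret NB: normal_pair UNIV b bs
    using normal_operator_imp_normal_pair(1)[OF assms(3)] by (simp add: domB b_def bs_def)
  have adjB: "is_adjoint b bs"
    by (simp add: is_adjoint_def NB.adj)
  obtain K where K: "\<And>x. norm (b x) \<le> K * norm x"
    using assms(2) by (auto simp: bounded_operator_def b_def)
  have bound: "norm (b x) \<le> \<bar>K\<bar> * norm x" for x
    using K[of x] by (meson abs_ge_self mult_right_mono norm_ge_zero order_trans)
  have C_Some: "?C x = Some z \<longleftrightarrow> b x \<in> ?D \<and> f (b x) = z" for x z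
    unfolding map_comp_eq_Some by (simp add: domB b_def f_def)
  have domC: "dom ?C = {x. b x \<in> ?D}" and C_eq: "b x \<in> ?D \<Longrightarrow> ?C x = Some (f (b x))" for x
    using C_Some by auto
  have commute: "b x \<in> ?D \<and> b (f x) = l *\<^sub>C f (b x)" if "x \<in> ?D" for x
  proof -
    have "(B \<circ>\<^sub>m A) x = Some (b (f x))"
      unfolding map_comp_eq_Some using that by (simp add: domB b_def f_def)
    then have "scale_operator l ?C x = Some (b (f x))"
      using assms(4) by (metis domI map_le_def)
    then obtain z where "?C x = Some z" "b (f x) = l *\<^sub>C z"
      by (auto simp: scale_operator_def)
    then show ?thesis
      by (simp add: C_Some)
  qed
  obtain x where x: "b x \<in> ?D" "l *\<^sub>C f (b x) \<noteq> 0"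
  proof -
    obtain x where "x \<in> dom (scale_operator l ?C)" and nz: "the (scale_operator l ?C x) \<noteq> 0"
      using assms(5) by blast
    then have "b x \<in> ?D"
      using domC by (auto simp: scale_operator_def dom_def)
    with nz show thesis
      by (intro that[of x]) (simp_all add: scale_operator_def C_eq)
  qed
  then have l: "l \<noteq> 0" and fbx: "f (b x) \<noteq> 0"
    by auto
  interpret I: intertwining ?D f g b bs "\<bar>K\<bar>" l
    by unfold_locales (use adjB bound l commute NB.norm_eq in auto)
  show ?thesis
  proof
    assume normal: "normal_operator ?C"
    let ?h = "\<lambda>x. the (adjoint_operator ?C x)"
    interpret C: normal_pair "dom ?C" "\<lambda>x. the (?C x)" ?h
      by (rule normal_operator_imp_normal_pair[OF normal])
    \<comment> \<open>The given \<open>x\<close> may lie outside \<open>?D\<close>;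
      \<open>product_eq_0\<close> supplies a witness in \<open>?D\<close>, where the adjoint of
      \<open>?C\<close> acts as \<open>bs g\<close>.\<close>
    obtain u where u: "u \<in> ?D" "f (b u) \<noteq> 0"
      using I.product_eq_0 x(1) fbx by blast
    have bu: "b u \<in> ?D"
      by (rule I.B_mem[OF u(1)])
    have "cinner (the (?C y)) u = cinner y (bs (g u))" if "y \<in> dom ?C" for y
      using that N.adj[OF _ u(1), of "b y"] by (simp add: domC C_eq I.B_adj)
    then have "?h u = bs (g u)"
      using C.max_right by blast
    then have "norm (f (b u)) = cmod l * norm (f (b u))"
      using C.norm_eq[of u] bu by (simp add: domC C_eq I.norm_Bs_g[OF u(1)])
    with u(2) show "cmod l = 1"
      by simp
  next
    assume l1: "cmod l = 1"
    interpret U: unimodular_intertwining ?D f g b bs "\<bar>K\<bar>" l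
      by (intro unimodular_intertwining.intro I.intertwining_axioms
          unimodular_intertwining_axioms.intro l1)
    show "normal_operator ?C"
    proof (rule normal_operatorI[OF U.product_normal domC])
      show "the (?C x) = f (b x)" if "x \<in> {x. b x \<in> ?D}" for x
        using that by (simp add: C_eq)
      have "b 0 = 0"
        using I.B_linear(2)[of 0 0] by simp
      then show "linear_operator ?C"
        unfolding linear_operator_def domC
        by (auto simp: C_eq I.B_linear N.linear)
      have "closure ?D \<subseteq> closure (dom ?C)"
        unfolding domC using I.B_mem by (intro closure_mono) auto
      then show "densely_defined ?C"
        using assms(1) by (auto simp: densely_defined_def normal_operator_def)
    qed
  qed
qed

end
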